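(* Let $\varphi:[-1,1]\to\mathbb{R}$ be analytic with $\varphi'(y)>0$ for all $y\in[-1,1]$, and let $\widetilde\varphi$ denote the maximal analytic extension of $\varphi$ that remains monotone increasing. If the range of every element of $\mathcal{A}(\varphi)$ is contained in the range of $\widetilde\varphi$, then $\mathcal{A}(\varphi)=\{\varphi\}$.
   Context: Let $\Omega=\mathbb{R}\times(-1,1)$. $\mathcal{A}(\varphi)$ is the class of functions $\psi$, real-analytic up to the boundary on $\overline\Omega=\mathbb{R}\times[-1,1]$, such that $\nabla^\perp\psi\cdot\nabla\Delta\psi=0$ in $\Omega$ (with $\nabla^\perp\psi=(-\partial_y\psi,\partial_x\psi)$), $\psi(x,\pm1)=\varphi(\pm1)$ for all $x\in\mathbb{R}$, and $\lim_{|x|\to\infty}\|\psi(x,\cdot)-\varphi(\cdot)\|_{C^2([-1,1])}=0$. In $\mathcal{A}(\varphi)=\{\varphi\}$, $\varphi$ is identified with the shear flow $(x,y)\mapsto\varphi(y)$. The maximal monotone analytic extension $\widetilde\varphi:(a,b)\to\mathbb{R}$ is defined as follows: $(a,b)$ (possibly infinite) is the largest open interval containing $[-1,1]$ to which $\varphi$ extends analytically as a function $\widetilde\varphi$ with $\widetilde\varphi\equiv\varphi$ on $[-1,1]$ and $\widetilde\varphi'(y)>0$ for all $y\in(a,b)$. *)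

theory Defs
  imports "HOL-Analysis.Analysis"
begin

definition strip :: "(real \<times> real) set" where
  "strip = UNIV \<times> {-1<..<1}"

definition cstrip :: "(real \<times> real) set" where
  "cstrip = UNIV \<times> {-1..1}"

text \<open>Real-analyticity on a set that need not be open: near each point of \<open>S\<close> the function
  agrees, on \<open>S\<close>, with a convergent power series. For \<open>S = {-1..1}\<close> and \<open>S = cstrip\<close> this is
  analyticity up to the boundary, since the power series at a boundary point converges in a full
  neighbourhood and so extends the function there.\<close>

definition real_analytic_on1 :: "(real \<Rightarrow> real) \<Rightarrow> real set \<Rightarrow> bool" where
  "real_analytic_on1 f S \<longleftrightarrow>
    (\<forall>t\<in>S. \<exists>r>0. \<exists>c :: nat \<Rightarrow> real. \<forall>s\<in>S. \<bar>s - t\<bar> < r \<longrightarrow>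
      (\<lambda>n. c n * (s - t) ^ n) sums f s)"

definition real_analytic_on2 :: "(real \<times> real \<Rightarrow> real) \<Rightarrow> (real \<times> real) set \<Rightarrow> bool" where
  "real_analytic_on2 f S \<longleftrightarrow>
    (\<forall>(x0, y0)\<in>S. \<exists>r>0. \<exists>c :: nat \<Rightarrow> nat \<Rightarrow> real. \<forall>(x, y)\<in>S. \<bar>x - x0\<bar> < r \<and> \<bar>y - y0\<bar> < r \<longrightarrow>
      ((\<lambda>(i, j). c i j * (x - x0) ^ i * (y - y0) ^ j) has_sum f (x, y)) UNIV)"

definition pdx :: "(real \<times> real \<Rightarrow> real) \<Rightarrow> real \<times> real \<Rightarrow> real" where
  "pdx f = (\<lambda>(x, y). deriv (\<lambda>s. f (s, y)) x)"

definition pdy :: "(real \<times> real \<Rightarrow> real) \<Rightarrow> real \<times> real \<Rightarrow> real" where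
  "pdy f = (\<lambda>(x, y). deriv (\<lambda>s. f (x, s)) y)"

definition grad :: "(real \<times> real \<Rightarrow> real) \<Rightarrow> real \<times> real \<Rightarrow> real \<times> real" where
  "grad f p = (pdx f p, pdy f p)"

definition perp_grad :: "(real \<times> real \<Rightarrow> real) \<Rightarrow> real \<times> real \<Rightarrow> real \<times> real" where
  "perp_grad f p = (- pdy f p, pdx f p)"

definition laplacian :: "(real \<times> real \<Rightarrow> real) \<Rightarrow> real \<times> real \<Rightarrow> real" where
  "laplacian f p = pdx (pdx f) p + pdy (pdy f) p"

text \<open>Derivative of a function on \<open>[-1,1]\<close>, one-sided at the endpoints; values of the function
  outside \<open>[-1,1]\<close> are irrelevant.\<close>

definition deriv_I :: "(real \<Rightarrow> real) \<Rightarrow> real \<Rightarrow> real" where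
  "deriv_I f t = vector_derivative f (at t within {-1..1})"

text \<open>The suprema are meaningful for functions of class \<open>C\<^sup>2\<close> on \<open>[-1,1]\<close>, in particular for
  analytic ones, which is the only case used.\<close>

definition C2_norm :: "(real \<Rightarrow> real) \<Rightarrow> real" where
  "C2_norm f = (\<Sum>k\<le>2. SUP t\<in>{-1..1}. \<bar>(deriv_I ^^ k) f t\<bar>)"

text \<open>Functions on the closed strip are total functions that are \<open>undefined\<close> outside it, so that
  equality of functions is equality on the closed strip. The differential equation is imposed
  only on the open strip, where the derivatives do not see the values outside.\<close>

definition steady_class :: "(real \<Rightarrow> real) \<Rightarrow> (real \<times> real \<Rightarrow> real) set" where
  "steady_class \<phi> = {\<psi> \<in> extensional cstrip.
     real_analytic_on2 \<psi> cstrip \<and>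
     (\<forall>p\<in>strip. perp_grad \<psi> p \<bullet> grad (laplacian \<psi>) p = 0) \<and>
     (\<forall>x. \<psi> (x, 1) = \<phi> 1 \<and> \<psi> (x, -1) = \<phi> (-1)) \<and>
     ((\<lambda>x. C2_norm (\<lambda>y. \<psi> (x, y) - \<phi> y)) \<longlongrightarrow> 0) at_infinity}"

definition shear_flow :: "(real \<Rightarrow> real) \<Rightarrow> real \<times> real \<Rightarrow> real" where
  "shear_flow \<phi> = restrict (\<lambda>(x, y). \<phi> y) cstrip"

definition monotone_analytic_extension ::
    "(real \<Rightarrow> real) \<Rightarrow> ereal \<Rightarrow> ereal \<Rightarrow> (real \<Rightarrow> real) \<Rightarrow> bool" where
  "monotone_analytic_extension \<phi> a b f \<longleftrightarrow>
     {-1..1} \<subseteq> einterval a b \<and>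
     real_analytic_on1 f (einterval a b) \<and>
     (\<forall>y\<in>{-1..1}. f y = \<phi> y) \<and>
     (\<forall>y\<in>einterval a b. deriv f y > 0)"

text \<open>For \<open>\<phi>\<close> analytic on \<open>[-1,1]\<close> with positive derivative, the identity theorem makes any two
  such extensions agree on the intersection of their intervals; hence a largest interval exists
  and determines the extension on it.\<close>

definition maximal_monotone_analytic_extension ::
    "(real \<Rightarrow> real) \<Rightarrow> ereal \<Rightarrow> ereal \<Rightarrow> (real \<Rightarrow> real) \<Rightarrow> bool" where
  "maximal_monotone_analytic_extension \<phi> a b f \<longleftrightarrow>
     monotone_analytic_extension \<phi> a b f \<and>
     (\<forall>a' b' g. monotone_analytic_extension \<phi> a' b' g \<longrightarrow> einterval a' b' \<subseteq> einterval a b)"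

end

theory Submission
  imports Defs "HOL-Complex_Analysis.Conformal_Mappings"
begin

text \<open>
  Let \<open>\<psi>\<close> be a steady state. Since the range of \<open>\<psi>\<close> lies in that of the increasing function
  \<open>\<phi>t\<close>, one can write \<open>\<psi> = \<phi>t \<circ> height\<close> with a function \<open>height\<close> on the closed strip; the task
  is to show \<open>height (x, y) = y\<close>.

  The first step is the semilinear equation \<open>laplacian \<psi> = \<phi>t'' \<circ> height\<close>. For large \<open>x\<close> the
  \<open>y\<close>-derivative of \<open>\<psi>\<close> is positive, the level curves are graphs reaching to infinity, and the
  vorticity is constant along them (\<open>constant_along_level_curves\<close>). Its value is found by
  passing to the limit along the curve: the hypotheses control only \<open>y\<close>-derivatives at infinity,
  but a convergent function whose second derivative converges has second derivative tending to zero
  (\<open>limit_second_derivative_zero\<close>), so the limit of the vorticity is \<open>\<phi>t''\<close>. From the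
  half-strip the equation spreads to the whole strip by the identity theorem applied on
  each horizontal line (\<open>hol_ext_on_zero_propagates\<close>), because \<open>\<phi>t'' \<circ> height\<close> is
  analytic everywhere.

  The second step is uniqueness. Written for \<open>height\<close>, the equation becomes
  \<open>\<Delta> height = (\<phi>t'' / \<phi>t')(height) * (1 - \<bar>\<nabla> height\<bar>\<^sup>2)\<close>. All translates \<open>y + c\<close> satisfy it,
  which is the analytic form of sliding the shear flow vertically; accordingly
  the equation for \<open>height - y\<close> contains only first and second derivatives, with a bounded
  coefficient, and a maximum principle (\<open>strip_max_principle\<close>) shows that this difference,
  being zero on the boundary and at infinity, is zero everywhere.

  Analyticity in one variable is expressed by local holomorphic extensions; in two variables it is used
  through absolutely convergent double power series, which may be differentiated term by term.
\<close>

section \<open>One-variable analyticity through holomorphic extensions\<close>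

text \<open>Analyticity of a function of one real variable, in a form that passes to derivatives, composites
and inverse functions at once: near each point of \<open>S\<close> the function is the restriction of a
holomorphic one. As in the power series definition, only the values on \<open>S\<close> are compared.\<close>

definition hol_ext_on :: "(real \<Rightarrow> real) \<Rightarrow> real set \<Rightarrow> bool" where
  "hol_ext_on f S \<longleftrightarrow>
    (\<forall>t\<in>S. \<exists>r>0. \<exists>\<Phi>. \<Phi> holomorphic_on ball (complex_of_real t) r \<and>
      (\<forall>s\<in>S. \<bar>s - t\<bar> < r \<longrightarrow> \<Phi> (of_real s) = of_real (f s)))"

lemma hol_ext_onE:
  assumes "hol_ext_on f S" "t \<in> S"
  obtains r \<Phi> where "r > 0" "\<Phi> holomorphic_on ball (complex_of_real t) r"
    "\<And>s. s \<in> S \<Longrightarrow> \<bar>s - t\<bar> < r \<Longrightarrow> \<Phi> (of_real s) = of_real (f s)"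
  using assms unfolding hol_ext_on_def by meson

lemma hol_ext_on_powser:
  fixes c :: "nat \<Rightarrow> real"
  assumes r: "r > 0" and sm: "summable (\<lambda>n. c n * r ^ n)"
    and f: "\<And>s. s \<in> S \<Longrightarrow> \<bar>s - t\<bar> < r \<Longrightarrow> (\<lambda>n. c n * (s - t) ^ n) sums f s"
  shows "\<exists>\<Phi>. \<Phi> holomorphic_on ball (complex_of_real t) r \<and>
      (\<forall>s\<in>S. \<bar>s - t\<bar> < r \<longrightarrow> \<Phi> (of_real s) = of_real (f s))"
proof (intro exI conjI ballI impI)
  define \<Phi> where "\<Phi> = (\<lambda>z. \<Sum>n. of_real (c n) * (z - complex_of_real t) ^ n)"
  have smC: "summable (\<lambda>n. complex_of_real (c n) * w ^ n)" if "norm w < r" for w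
  proof (rule powser_inside)
    have "summable (\<lambda>n. complex_of_real (c n * r ^ n))"
      using sm by (rule summable_of_real)
    then show "summable (\<lambda>n. complex_of_real (c n) * of_real r ^ n)" by simp
  qed (use that r in simp)
  show "\<Phi> holomorphic_on ball (complex_of_real t) r"
    unfolding \<Phi>_def
  proof (rule power_series_holomorphic)
    fix w assume "w \<in> ball (complex_of_real t) r"
    then have "norm (w - of_real t) < r" by (simp add: dist_norm norm_minus_commute)
    from smC[OF this]
    show "(\<lambda>n. complex_of_real (c n) * (w - of_real t) ^ n) sums
       (\<Sum>n. of_real (c n) * (w - complex_of_real t) ^ n)"
      by (rule summable_sums)
  qed
  fix s assume "s \<in> S" "\<bar>s - t\<bar> < r"
  from f[OF this] have "(\<lambda>n. complex_of_real (c n * (s - t) ^ n)) sums of_real (f s)"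
    by (rule sums_of_real)
  then show "\<Phi> (of_real s) = of_real (f s)"
    unfolding \<Phi>_def by (simp add: sums_iff)
qed

text \<open>The given series is only known to converge at points of \<open>S\<close>. Since \<open>t\<close> is a limit
point of \<open>S\<close>, one of these points differs from \<open>t\<close>, and convergence there gives
convergence in a complex disc.\<close>

lemma real_analytic_imp_hol_ext_on:
  assumes f: "real_analytic_on1 f S" and lim: "\<And>t. t \<in> S \<Longrightarrow> t islimpt S"
  shows "hol_ext_on f S"
  unfolding hol_ext_on_def
proof
  fix t assume t: "t \<in> S"
  then obtain r c where r: "r > 0"
    and c: "\<And>s. s \<in> S \<Longrightarrow> \<bar>s - t\<bar> < r \<Longrightarrow> (\<lambda>n. c n * (s - t) ^ n) sums f s"
    using f unfolding real_analytic_on1_def by meson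
  obtain s where s: "s \<in> S" "s \<noteq> t" "\<bar>s - t\<bar> < r"
    using lim[OF t] r unfolding islimpt_approachable by (auto simp: dist_real_def)
  define d where "d = \<bar>s - t\<bar> / 2"
  have d: "d > 0" "d < \<bar>s - t\<bar>" "d < r" using s by (auto simp: d_def)
  have "summable (\<lambda>n. c n * d ^ n)"
    using sums_summable[OF c[OF s(1,3)]] by (rule powser_inside) (use d in simp)
  moreover have "(\<lambda>n. c n * (s - t) ^ n) sums f s" if "s \<in> S" "\<bar>s - t\<bar> < d" for s
    using c[OF that(1)] that(2) d(3) by simp
  ultimately have "\<exists>\<Phi>. \<Phi> holomorphic_on ball (complex_of_real t) d \<and>
      (\<forall>s\<in>S. \<bar>s - t\<bar> < d \<longrightarrow> \<Phi> (of_real s) = of_real (f s))"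
    by (rule hol_ext_on_powser[OF d(1)])
  with d(1) show "\<exists>r>0. \<exists>\<Phi>. \<Phi> holomorphic_on ball (complex_of_real t) r \<and>
      (\<forall>s\<in>S. \<bar>s - t\<bar> < r \<longrightarrow> \<Phi> (of_real s) = of_real (f s))"
    by blast
qed

lemma hol_ext_vector_derivative:
  assumes "\<Phi> holomorphic_on ball (complex_of_real t) r"
    and "\<And>s. s \<in> S \<Longrightarrow> \<bar>s - t\<bar> < r \<Longrightarrow> \<Phi> (of_real s) = of_real (f s)"
    and "s \<in> S" "\<bar>s - t\<bar> < r"
  shows "((\<lambda>x. complex_of_real (f x)) has_vector_derivative deriv \<Phi> (of_real s)) (at s within S)"
proof -
  have "dist (complex_of_real t) (of_real s) = \<bar>s - t\<bar>"
    by (simp add: dist_of_real dist_real_def)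
  then have "complex_of_real s \<in> ball (of_real t) r"
    using assms(4) by simp
  then have "(\<Phi> has_field_derivative deriv \<Phi> (of_real s)) (at (of_real s))"
    using assms(1) by (intro holomorphic_derivI) auto
  then have "((\<lambda>x. \<Phi> (of_real x)) has_vector_derivative deriv \<Phi> (of_real s)) (at s within S)"
    using has_vector_derivative_at_within has_vector_derivative_real_field by blast
  then show ?thesis
  proof (rule has_vector_derivative_transform_within)
    show "r - \<bar>s - t\<bar> > 0" using assms(4) by simp
    fix x assume "x \<in> S" "dist x s < r - \<bar>s - t\<bar>"
    then show "\<Phi> (of_real x) = of_real (f x)"
      by (intro assms(2)) (auto simp: dist_real_def)
  qed (fact assms(3))
qed

lemma hol_ext_on_has_derivative:
  assumes "hol_ext_on f S" "t \<in> S"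
  shows "\<exists>D. (f has_real_derivative D) (at t within S)"
proof -
  obtain r \<Phi> where r: "r > 0" "\<Phi> holomorphic_on ball (complex_of_real t) r"
    "\<And>s. s \<in> S \<Longrightarrow> \<bar>s - t\<bar> < r \<Longrightarrow> \<Phi> (of_real s) = of_real (f s)"
    using hol_ext_onE[OF assms] by blast
  have "((\<lambda>x. complex_of_real (f x)) has_vector_derivative deriv \<Phi> (of_real t)) (at t within S)"
    by (rule hol_ext_vector_derivative[OF r(2,3)]) (use r assms in auto)
  then have "((\<lambda>x. Re (complex_of_real (f x))) has_vector_derivative Re (deriv \<Phi> (of_real t)))
      (at t within S)"
    unfolding has_vector_derivative_def
    by (auto dest: has_derivative_Re)
  then show ?thesis
    unfolding has_real_derivative_iff_has_vector_derivative by auto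
qed

text \<open>The derivative of the holomorphic extension extends the real derivative. Limit points are needed
for a derivative within \<open>S\<close> to be unique.\<close>

lemma hol_ext_on_derivative:
  assumes f: "hol_ext_on f S" and lim: "\<And>t. t \<in> S \<Longrightarrow> t islimpt S"
    and f': "\<And>t. t \<in> S \<Longrightarrow> (f has_real_derivative f' t) (at t within S)"
  shows "hol_ext_on f' S"
  unfolding hol_ext_on_def
proof
  fix t assume t: "t \<in> S"
  obtain r \<Phi> where r: "r > 0" "\<Phi> holomorphic_on ball (complex_of_real t) r"
    "\<And>s. s \<in> S \<Longrightarrow> \<bar>s - t\<bar> < r \<Longrightarrow> \<Phi> (of_real s) = of_real (f s)"
    using hol_ext_onE[OF f t] by blast
  have "deriv \<Phi> (of_real s) = of_real (f' s)" if s: "s \<in> S" "\<bar>s - t\<bar> < r" for s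
  proof (rule vector_derivative_unique_within)
    show "at s within S \<noteq> bot" using lim[OF s(1)] by (simp add: trivial_limit_within)
    show "((\<lambda>x. complex_of_real (f x)) has_vector_derivative deriv \<Phi> (of_real s)) (at s within S)"
      by (rule hol_ext_vector_derivative[OF r(2,3) s])
    show "((\<lambda>x. complex_of_real (f x)) has_vector_derivative of_real (f' s)) (at s within S)"
      using f'[OF s(1)] has_vector_derivative_of_real by blast
  qed
  moreover have "deriv \<Phi> holomorphic_on ball (complex_of_real t) r"
    using r(2) by (simp add: holomorphic_deriv)
  ultimately show "\<exists>r>0. \<exists>\<Phi>. \<Phi> holomorphic_on ball (complex_of_real t) r \<and>
      (\<forall>s\<in>S. \<bar>s - t\<bar> < r \<longrightarrow> \<Phi> (of_real s) = of_real (f' s))"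
    using r(1) by blast
qed

lemma hol_ext_on_continuous: "hol_ext_on f S \<Longrightarrow> continuous_on S f"
  using hol_ext_on_has_derivative DERIV_continuous
  unfolding continuous_on_eq_continuous_within by blast

lemma hol_ext_on_open_DERIV:
  assumes "hol_ext_on f S" "open S" "t \<in> S"
  shows "(f has_real_derivative deriv f t) (at t)"
proof -
  obtain D where "(f has_real_derivative D) (at t within S)"
    using hol_ext_on_has_derivative assms by blast
  then have "(f has_real_derivative D) (at t)"
    by (simp add: at_within_open[OF assms(3,2)])
  with DERIV_imp_deriv[OF this] show ?thesis by simp
qed

lemma hol_ext_on_deriv:
  assumes "hol_ext_on f S" "open S"
  shows "hol_ext_on (deriv f) S"
proof (rule hol_ext_on_derivative[OF assms(1)])
  show "t islimpt S" if "t \<in> S" for t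
    using that assms(2) by (simp add: interior_limit_point interior_open)
  show "(f has_real_derivative deriv f t) (at t within S)" if "t \<in> S" for t
    using hol_ext_on_open_DERIV[OF assms that] by (rule DERIV_subset) simp
qed

lemma hol_ext_on_diff:
  assumes f: "hol_ext_on f S" and g: "hol_ext_on g S"
  shows "hol_ext_on (\<lambda>x. f x - g x) S"
  unfolding hol_ext_on_def
proof
  fix t assume t: "t \<in> S"
  obtain r F where F: "r > 0" "F holomorphic_on ball (complex_of_real t) r"
    "\<And>s. s \<in> S \<Longrightarrow> \<bar>s - t\<bar> < r \<Longrightarrow> F (of_real s) = of_real (f s)"
    using hol_ext_onE[OF f t] by blast
  obtain r' G where G: "r' > 0" "G holomorphic_on ball (complex_of_real t) r'"
    "\<And>s. s \<in> S \<Longrightarrow> \<bar>s - t\<bar> < r' \<Longrightarrow> G (of_real s) = of_real (g s)"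
    using hol_ext_onE[OF g t] by blast
  have "(\<lambda>z. F z - G z) holomorphic_on ball (complex_of_real t) (min r r')"
    by (intro holomorphic_on_diff holomorphic_on_subset[OF F(2)] holomorphic_on_subset[OF G(2)]) auto
  then show "\<exists>r>0. \<exists>\<Phi>. \<Phi> holomorphic_on ball (complex_of_real t) r \<and>
      (\<forall>s\<in>S. \<bar>s - t\<bar> < r \<longrightarrow> \<Phi> (of_real s) = of_real (f s - g s))"
    using F(1,3) G(1,3) by (intro exI[of _ "min r r'"]) auto
qed

lemma hol_ext_on_compose:
  assumes g: "hol_ext_on g T" and f: "hol_ext_on f S" and sub: "f ` S \<subseteq> T"
  shows "hol_ext_on (\<lambda>x. g (f x)) S"
  unfolding hol_ext_on_def
proof
  fix t assume t: "t \<in> S"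
  obtain r F where F: "r > 0" "F holomorphic_on ball (complex_of_real t) r"
    "\<And>s. s \<in> S \<Longrightarrow> \<bar>s - t\<bar> < r \<Longrightarrow> F (of_real s) = of_real (f s)"
    using hol_ext_onE[OF f t] by blast
  obtain q G where G: "q > 0" "G holomorphic_on ball (complex_of_real (f t)) q"
    "\<And>s. s \<in> T \<Longrightarrow> \<bar>s - f t\<bar> < q \<Longrightarrow> G (of_real s) = of_real (g s)"
    using hol_ext_onE[OF g, of "f t"] sub t by blast
  have Ft: "F (of_real t) = of_real (f t)" using F t by simp
  have "isCont F (of_real t)"
    using F(1,2) by (meson centre_in_ball continuous_on_eq_continuous_at
        holomorphic_on_imp_continuous_on open_ball)
  then obtain d where d: "d > 0"
    "\<And>z. dist z (of_real t) < d \<Longrightarrow> dist (F z) (of_real (f t)) < q"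
    using G(1) Ft unfolding continuous_at_eps_delta by metis
  define e where "e = min r d"
  have "F holomorphic_on ball (of_real t) e"
    by (rule holomorphic_on_subset[OF F(2)]) (auto simp: e_def)
  moreover have "F ` ball (of_real t) e \<subseteq> ball (of_real (f t)) q"
    using d(2) by (auto simp: e_def dist_commute)
  ultimately have "(G \<circ> F) holomorphic_on ball (of_real t) e"
    using G(2) by (blast intro: holomorphic_on_compose_gen)
  moreover have "(G \<circ> F) (of_real s) = of_real (g (f s))" if s: "s \<in> S" "\<bar>s - t\<bar> < e" for s
  proof -
    have 1: "F (of_real s) = of_real (f s)" using F s by (auto simp: e_def)
    have "dist (complex_of_real s) (of_real t) < d"
      using s by (simp add: e_def dist_of_real dist_real_def)
    from d(2)[OF this] have "\<bar>f s - f t\<bar> < q"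
      by (simp add: 1 dist_of_real dist_real_def)
    then show ?thesis using G(3) 1 sub s(1) by auto
  qed
  ultimately show "\<exists>r>0. \<exists>\<Phi>. \<Phi> holomorphic_on ball (complex_of_real t) r \<and>
      (\<forall>s\<in>S. \<bar>s - t\<bar> < r \<longrightarrow> \<Phi> (of_real s) = of_real (g (f s)))"
    using F(1) d(1) by (intro exI[of _ e]) (auto simp: e_def)
qed

text \<open>At a point where the real derivative does not vanish, neither does that of the holomorphic
extension, which therefore has a local holomorphic inverse \<open>G\<close>. Continuity of \<open>g\<close>
ensures that near \<open>c\<close> it takes its values in the disc on which \<open>G\<close> inverts \<open>F\<close>.\<close>

lemma hol_ext_on_inverse:
  assumes f: "hol_ext_on f S" and S: "open S" and d: "\<And>t. t \<in> S \<Longrightarrow> deriv f t \<noteq> 0"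
    and g: "\<And>t. t \<in> S \<Longrightarrow> g (f t) = t" and contg: "continuous_on (f ` S) g"
  shows "hol_ext_on g (f ` S)"
  unfolding hol_ext_on_def
proof
  fix c assume "c \<in> f ` S"
  then obtain t where t: "t \<in> S" "c = f t" by blast
  obtain r F where F: "r > 0" "F holomorphic_on ball (complex_of_real t) r"
    "\<And>s. s \<in> S \<Longrightarrow> \<bar>s - t\<bar> < r \<Longrightarrow> F (of_real s) = of_real (f s)"
    using hol_ext_onE[OF f t(1)] by blast
  have "((\<lambda>x. complex_of_real (f x)) has_vector_derivative deriv F (of_real t)) (at t within S)"
    by (rule hol_ext_vector_derivative[OF F(2,3)]) (use F t in auto)
  moreover have "((\<lambda>x. complex_of_real (f x)) has_vector_derivative of_real (deriv f t)) (at t within S)"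
    using hol_ext_on_open_DERIV[OF f S t(1)] has_vector_derivative_of_real
      has_field_derivative_at_within by blast
  ultimately have "deriv F (of_real t) = of_real (deriv f t)"
    unfolding at_within_open[OF t(1) S] by (rule vector_derivative_unique_at)
  with d[OF t(1)] have "deriv F (of_real t) \<noteq> 0" by simp
  then obtain q where q: "q > 0" "ball (of_real t) q \<subseteq> ball (complex_of_real t) r"
      "inj_on F (ball (of_real t) q)"
    using has_complex_derivative_locally_injective[OF F(2)] F(1) by (metis centre_in_ball open_ball)
  have F2: "F holomorphic_on ball (of_real t) q"
    using F(2) q(2) by (rule holomorphic_on_subset)
  obtain G where G: "G holomorphic_on F ` ball (of_real t) q"
      "\<And>z. z \<in> ball (of_real t) q \<Longrightarrow> G (F z) = z"
    using holomorphic_has_inverse[OF F2 open_ball q(3)] by metis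
  have "open (F ` ball (of_real t) q)"
    by (rule open_mapping_thm3[OF F2 open_ball q(3)])
  moreover have "F (of_real t) = of_real c" using F t by simp
  then have "of_real c \<in> F ` ball (of_real t) q"
    using q(1) by (force intro: image_eqI[of _ _ "of_real t"])
  ultimately obtain e where e: "e > 0" "ball (of_real c) e \<subseteq> F ` ball (of_real t) q"
    by (rule openE)
  obtain e' where e': "e' > 0"
      "\<And>s. s \<in> f ` S \<Longrightarrow> \<bar>s - c\<bar> < e' \<Longrightarrow> \<bar>g s - g c\<bar> < min q r"
    using contg q(1) F(1) t unfolding continuous_on_iff dist_real_def
    by (metis image_eqI min_less_iff_conj)
  have "G holomorphic_on ball (of_real c) (min e e')"
    by (rule holomorphic_on_subset[OF G(1)]) (use e in auto)
  moreover have "G (of_real s) = of_real (g s)" if s: "s \<in> f ` S" "\<bar>s - c\<bar> < min e e'" for s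
  proof -
    obtain u where u: "u \<in> S" "s = f u" using s by blast
    have "\<bar>u - t\<bar> < min q r" using e'(2)[OF s(1)] s(2) u t g by auto
    then have "F (of_real u) = of_real s" "complex_of_real u \<in> ball (of_real t) q"
      using F(3) u by (auto simp: dist_of_real dist_real_def)
    then show ?thesis using G(2) u g by metis
  qed
  ultimately show "\<exists>r>0. \<exists>\<Phi>. \<Phi> holomorphic_on ball (complex_of_real c) r \<and>
      (\<forall>s\<in>f ` S. \<bar>s - c\<bar> < r \<longrightarrow> \<Phi> (of_real s) = of_real (g s))"
    using e(1) e'(1) by (intro exI[of _ "min e e'"]) auto
qed

text \<open>Identity theorem on the line: the interior of the zero set is closed, because at one of its limit
points the local holomorphic extension has a non-isolated zero.\<close>

lemma hol_ext_on_zero_propagates: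
  assumes f: "hol_ext_on f UNIV" and z: "\<And>x. x > R \<Longrightarrow> f x = 0"
  shows "f x = 0"
proof -
  define A where "A = interior {x. f x = 0}"
  have lim: "f y = 0 \<and> y \<in> A" if y: "y islimpt A" for y
  proof -
    obtain r F where F: "r > 0" "F holomorphic_on ball (complex_of_real y) r"
      "\<And>s. \<bar>s - y\<bar> < r \<Longrightarrow> F (of_real s) = of_real (f s)"
      using hol_ext_onE[OF f UNIV_I] by (metis UNIV_I)
    have "F w = 0" if "w \<in> ball (of_real y) r" for w
    proof (rule analytic_continuation[OF F(2) open_ball convex_connected[OF convex_ball]])
      show "complex_of_real ` (A \<inter> {y - r<..<y + r}) \<subseteq> ball (of_real y) r"
        by (auto simp: dist_of_real dist_real_def)
      have "y islimpt (A \<inter> {y - r<..<y + r})"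
        unfolding islimpt_approachable
      proof (intro allI impI)
        fix e :: real assume "e > 0"
        then obtain s where "s \<in> A" "s \<noteq> y" "dist s y < min e r"
          using y F(1) unfolding islimpt_approachable by (metis min_less_iff_conj)
        then show "\<exists>s\<in>A \<inter> {y - r<..<y + r}. s \<noteq> y \<and> dist s y < e"
          by (intro bexI[of _ s]) (auto simp: dist_real_def)
      qed
      then show "complex_of_real y islimpt complex_of_real ` (A \<inter> {y - r<..<y + r})"
        unfolding islimpt_approachable by (auto simp: dist_of_real)
      fix z assume "z \<in> complex_of_real ` (A \<inter> {y - r<..<y + r})"
      then obtain s where s: "s \<in> A" "\<bar>s - y\<bar> < r" "z = of_real s" by auto
      then have "f s = 0" using interior_subset unfolding A_def by blast
      then show "F z = 0" using F(3) s by simp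
    qed (use F(1) that in auto)
    then have *: "f s = 0" if "s \<in> ball y r" for s
      using F(3)[of s] that by (auto simp: dist_of_real dist_real_def abs_minus_commute)
    then have "ball y r \<subseteq> {x. f x = 0}" by auto
    then have "ball y r \<subseteq> A" unfolding A_def by (simp add: interior_maximal)
    then show ?thesis using F(1) * by (meson centre_in_ball subsetD)
  qed
  have "closed A" using lim by (meson closed_limpt)
  moreover have "open A" by (simp add: A_def)
  moreover have "{R<..} \<subseteq> A" unfolding A_def by (rule interior_maximal) (use z in auto)
  then have "A \<noteq> {}" by (meson greaterThan_non_empty order_trans subset_empty)
  ultimately have "A = UNIV" using clopen by blast
  then show ?thesis using interior_subset unfolding A_def by blast
qed

section \<open>Double power series\<close>

lemma real_analytic_on2D:
  assumes f: "real_analytic_on2 f S" and p: "(x0, y0) \<in> S"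
  obtains r c where "r > 0"
    "\<And>x y. (x, y) \<in> S \<Longrightarrow> \<bar>x - x0\<bar> < r \<Longrightarrow> \<bar>y - y0\<bar> < r \<Longrightarrow>
      ((\<lambda>(i, j). c i j * (x - x0) ^ i * (y - y0) ^ j) has_sum f (x, y)) UNIV"
proof -
  from f p have "\<exists>r>0. \<exists>c. \<forall>(x, y)\<in>S. \<bar>x - x0\<bar> < r \<and> \<bar>y - y0\<bar> < r \<longrightarrow>
      ((\<lambda>(i, j). c i j * (x - x0) ^ i * (y - y0) ^ j) has_sum f (x, y)) UNIV"
    unfolding real_analytic_on2_def by auto
  then obtain r c where "r > 0" "\<forall>(x, y)\<in>S. \<bar>x - x0\<bar> < r \<and> \<bar>y - y0\<bar> < r \<longrightarrow>
      ((\<lambda>(i, j). c i j * (x - x0) ^ i * (y - y0) ^ j) has_sum f (x, y)) UNIV" by blast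
  then show ?thesis by (intro that[of r c]) auto
qed

text \<open>Convergence at a point displaced by \<open>s\<close> in both coordinates bounds all terms of the double series
on the square of half-side \<open>s\<close>. The corner condition provides such a point inside \<open>S\<close>; it
holds for open sets and for the closed strip alike.\<close>

lemma real_analytic_on2E:
  assumes f: "real_analytic_on2 f S" and p: "(x0, y0) \<in> S"
    and corner: "\<And>e. e > 0 \<Longrightarrow>
      \<exists>x y. (x, y) \<in> S \<and> 0 < \<bar>x - x0\<bar> \<and> \<bar>x - x0\<bar> = \<bar>y - y0\<bar> \<and> \<bar>x - x0\<bar> < e"
  obtains s c where "s > 0"
    "(\<lambda>(i, j). \<bar>c i j\<bar> * s ^ i * s ^ j) summable_on UNIV"
    "\<And>x y. (x, y) \<in> S \<Longrightarrow> \<bar>x - x0\<bar> < s \<Longrightarrow> \<bar>y - y0\<bar> < s \<Longrightarrow>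
      ((\<lambda>(i, j). c i j * (x - x0) ^ i * (y - y0) ^ j) has_sum f (x, y)) UNIV"
proof -
  obtain r and c :: "nat \<Rightarrow> nat \<Rightarrow> real" where r: "r > 0" and c: "\<And>x y. (x, y) \<in> S \<Longrightarrow> \<bar>x - x0\<bar> < r \<Longrightarrow> \<bar>y - y0\<bar> < r \<Longrightarrow>
      ((\<lambda>(i, j). c i j * (x - x0) ^ i * (y - y0) ^ j) has_sum f (x, y)) UNIV"
    by (rule real_analytic_on2D[OF f p], rule that)
  obtain x y where xy: "(x, y) \<in> S" "0 < \<bar>x - x0\<bar>" "\<bar>x - x0\<bar> = \<bar>y - y0\<bar>" "\<bar>x - x0\<bar> < r"
    using corner[OF r] by blast
  define s where "s = \<bar>x - x0\<bar>"
  have "(\<lambda>(i, j). c i j * (x - x0) ^ i * (y - y0) ^ j) summable_on UNIV"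
    using c[of x y] xy by (auto simp: summable_on_def)
  from summable_on_iff_abs_summable_on_real[THEN iffD1, OF this]
  have "(\<lambda>p. \<bar>case p of (i, j) \<Rightarrow> c i j * (x - x0) ^ i * (y - y0) ^ j\<bar>) summable_on UNIV"
    by (simp only: real_norm_def)
  also have "(\<lambda>p. \<bar>case p of (i, j) \<Rightarrow> c i j * (x - x0) ^ i * (y - y0) ^ j\<bar>)
      = (\<lambda>(i, j). \<bar>c i j\<bar> * s ^ i * s ^ j)"
    using xy(3) by (auto simp: s_def abs_mult power_abs)
  finally show ?thesis
    using that[of s c] xy c by (auto simp: s_def)
qed

lemma double_powser_summable:
  fixes c :: "nat \<Rightarrow> nat \<Rightarrow> real"
  assumes "(\<lambda>(i, j). \<bar>c i j\<bar> * s ^ i * s ^ j) summable_on UNIV" "\<bar>u\<bar> \<le> s" "\<bar>v\<bar> \<le> s"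
  shows "(\<lambda>(i, j). c i j * u ^ i * v ^ j) summable_on UNIV"
proof -
  have "(\<lambda>p. norm (case p of (i, j) \<Rightarrow> c i j * u ^ i * v ^ j)) summable_on UNIV"
    using assms(1)
  proof (rule Infinite_Sum.abs_summable_on_comparison_test', safe)
    fix i j
    have "\<bar>u\<bar> ^ i \<le> s ^ i" "\<bar>v\<bar> ^ j \<le> s ^ j" using assms by (auto intro: power_mono)
    then show "norm (c i j * u ^ i * v ^ j) \<le> \<bar>c i j\<bar> * s ^ i * s ^ j"
      using assms by (auto simp: abs_mult power_abs intro!: mult_mono)
  qed
  then show ?thesis using summable_on_iff_abs_summable_on_real by blast
qed

lemma real_analytic_on2_continuous:
  assumes f: "real_analytic_on2 f S"
    and corner: "\<And>x0 y0 e. (x0, y0) \<in> S \<Longrightarrow> e > 0 \<Longrightarrow>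
      \<exists>x y. (x, y) \<in> S \<and> 0 < \<bar>x - x0\<bar> \<and> \<bar>x - x0\<bar> = \<bar>y - y0\<bar> \<and> \<bar>x - x0\<bar> < e"
  shows "continuous_on S f"
  unfolding continuous_on_eq_continuous_within
proof
  fix p assume p: "p \<in> S"
  obtain x0 y0 where p': "p = (x0, y0)" by fastforce
  with p have xy: "(x0, y0) \<in> S" by simp
  obtain s and c :: "nat \<Rightarrow> nat \<Rightarrow> real" where s: "s > 0"
    and M: "(\<lambda>(i, j). \<bar>c i j\<bar> * s ^ i * s ^ j) summable_on UNIV"
    and c: "\<And>x y. (x, y) \<in> S \<Longrightarrow> \<bar>x - x0\<bar> < s \<Longrightarrow> \<bar>y - y0\<bar> < s \<Longrightarrow>
      ((\<lambda>(i, j). c i j * (x - x0) ^ i * (y - y0) ^ j) has_sum f (x, y)) UNIV"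
    by (rule real_analytic_on2E[OF f xy corner[OF xy]], assumption, rule that)
  define B where "B = {x0 - s<..<x0 + s} \<times> {y0 - s<..<y0 + s}"
  define T where "T = (\<lambda>(i, j) (x, y). c i j * (x - x0) ^ i * (y - y0) ^ j)"
  have "uniform_limit (S \<inter> B) (\<lambda>X q. \<Sum>k\<in>X. T k q) f (finite_subsets_at_top UNIV)"
  proof (rule Weierstrass_m_test_general'[OF _ _ M])
    fix k :: "nat \<times> nat" and q assume "q \<in> S \<inter> B"
    then obtain x y where q: "q = (x, y)" "\<bar>x - x0\<bar> < s" "\<bar>y - y0\<bar> < s" "(x, y) \<in> S"
      unfolding B_def by (auto simp: abs_less_iff)
    obtain i j where k: "k = (i, j)" by fastforce
    have "\<bar>x - x0\<bar> ^ i \<le> s ^ i" "\<bar>y - y0\<bar> ^ j \<le> s ^ j"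
      using q by (auto intro: power_mono)
    then show "norm (T k q) \<le> (case k of (i, j) \<Rightarrow> \<bar>c i j\<bar> * s ^ i * s ^ j)"
      using s by (auto simp: T_def q k abs_mult power_abs intro!: mult_mono)
  next
    fix q assume "q \<in> S \<inter> B"
    then obtain x y where q: "q = (x, y)" "\<bar>x - x0\<bar> < s" "\<bar>y - y0\<bar> < s" "(x, y) \<in> S"
      unfolding B_def by (auto simp: abs_less_iff)
    have "(\<lambda>k. T k q) = (\<lambda>(i, j). c i j * (x - x0) ^ i * (y - y0) ^ j)"
      by (auto simp: T_def q)
    then show "((\<lambda>k. T k q) has_sum f q) UNIV" using c q by simp
  qed
  moreover have "continuous_on (S \<inter> B) (\<lambda>q. \<Sum>k\<in>X. T k q)" for X
    unfolding T_def case_prod_beta by (intro continuous_intros)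
  ultimately have "continuous_on (S \<inter> B) f"
    by (intro uniform_limit_theorem) auto
  moreover have "open B" "p \<in> B" using s by (auto simp: B_def p' open_Times)
  moreover from this have "at p within S = at p within (S \<inter> B)"
    by (intro at_within_nhd[of p B]) auto
  ultimately show "continuous (at p within S) f"
    using p by (simp add: continuous_on_eq_continuous_within)
qed

lemma of_nat_times_geometric_bounded:
  fixes q :: real
  assumes "0 \<le> q" "q < 1"
  obtains K where "\<And>i. of_nat (Suc i) * q ^ i \<le> K" "K \<ge> 0"
proof -
  have "(\<lambda>n. of_nat n * q ^ n) \<longlonglongrightarrow> 0"
    using assms by (intro powser_times_n_limit_0) simp
  then have "Bseq (\<lambda>n. of_nat n * q ^ n)"
    by (intro convergent_imp_Bseq) (auto simp: convergent_def)
  then obtain K where K: "K > 0" "\<And>n. norm (of_nat n * q ^ n) \<le> K"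
    by (auto elim: BseqE)
  have "of_nat (Suc i) * q ^ i \<le> K + 1" for i
  proof -
    have "q ^ i \<le> 1" using assms by (simp add: power_le_one)
    then show ?thesis using K(2)[of i] by (simp add: algebra_simps)
  qed
  then show ?thesis using that[of "K + 1"] K(1) by simp
qed

text \<open>On a smaller square the factor \<open>Suc i\<close> from differentiation is absorbed by the geometric gain
\<open>(\<bar>u\<bar> / s) ^ i\<close>.\<close>

lemma double_powser_diff_summable:
  fixes c :: "nat \<Rightarrow> nat \<Rightarrow> real"
  assumes M: "(\<lambda>(i, j). \<bar>c i j\<bar> * s ^ i * s ^ j) summable_on UNIV"
    and u: "\<bar>u\<bar> < s" and v: "\<bar>v\<bar> \<le> s"
  shows "(\<lambda>(i, j). of_nat (Suc i) * c (Suc i) j * u ^ i * v ^ j) summable_on UNIV"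
proof -
  have s: "s > 0" using u by simp
  obtain K where K: "\<And>i. of_nat (Suc i) * (\<bar>u\<bar> / s) ^ i \<le> K" "K \<ge> 0"
    using of_nat_times_geometric_bounded[of "\<bar>u\<bar> / s"] u by auto
  define h where "h = map_prod Suc (id :: nat \<Rightarrow> nat)"
  have "inj h" by (auto simp: h_def inj_on_def)
  moreover have "(\<lambda>(i, j). \<bar>c i j\<bar> * s ^ i * s ^ j) summable_on range h"
    using M by (rule summable_on_subset_banach) simp
  ultimately have "((\<lambda>(i, j). \<bar>c i j\<bar> * s ^ i * s ^ j) \<circ> h) summable_on UNIV"
    using summable_on_reindex by blast
  then have "(\<lambda>p. (K / s) * ((\<lambda>(i, j). \<bar>c i j\<bar> * s ^ i * s ^ j) \<circ> h) p) summable_on UNIV"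
    by (rule summable_on_cmult_right)
  then have "(\<lambda>p. norm (case p of (i, j) \<Rightarrow> of_nat (Suc i) * c (Suc i) j * u ^ i * v ^ j))
      summable_on UNIV"
  proof (rule Infinite_Sum.abs_summable_on_comparison_test', safe)
    fix i j
    have "of_nat (Suc i) * \<bar>u\<bar> ^ i = of_nat (Suc i) * (\<bar>u\<bar> / s) ^ i * s ^ i"
      using s by (simp add: power_divide)
    also have "\<dots> \<le> K * s ^ i" using K(1) s by (intro mult_right_mono) auto
    finally have 1: "of_nat (Suc i) * \<bar>u\<bar> ^ i \<le> K * s ^ i" .
    have 2: "\<bar>v\<bar> ^ j \<le> s ^ j" using v by (auto intro: power_mono)
    have "norm (of_nat (Suc i) * c (Suc i) j * u ^ i * v ^ j)
        = \<bar>c (Suc i) j\<bar> * ((of_nat (Suc i) * \<bar>u\<bar> ^ i) * \<bar>v\<bar> ^ j)"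
      by (simp add: abs_mult power_abs)
    also have "\<dots> \<le> \<bar>c (Suc i) j\<bar> * ((K * s ^ i) * s ^ j)"
      using K(2) s by (intro mult_left_mono mult_mono[OF 1 2]) auto
    also have "\<dots> = (K / s) * ((\<lambda>(i, j). \<bar>c i j\<bar> * s ^ i * s ^ j) \<circ> h) (i, j)"
      using s by (simp add: h_def)
    finally show "norm (of_nat (Suc i) * c (Suc i) j * u ^ i * v ^ j)
      \<le> (K / s) * ((\<lambda>(i, j). \<bar>c i j\<bar> * s ^ i * s ^ j) \<circ> h) (i, j)" .
  qed
  then show ?thesis using summable_on_iff_abs_summable_on_real by blast
qed

text \<open>For fixed \<open>v\<close>, summation over \<open>j\<close> first leaves a power series in \<open>u\<close> alone, which may be
differentiated term by term; absolute summability then permits undoing the rearrangement.\<close>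

lemma double_powser_deriv:
  fixes c :: "nat \<Rightarrow> nat \<Rightarrow> real"
  assumes M: "(\<lambda>(i, j). \<bar>c i j\<bar> * s ^ i * s ^ j) summable_on UNIV"
    and u: "\<bar>u\<bar> < s" and v: "\<bar>v\<bar> \<le> s"
    and F: "\<And>w. \<bar>w\<bar> < s \<Longrightarrow> ((\<lambda>(i, j). c i j * w ^ i * v ^ j) has_sum F w) UNIV"
  shows "\<exists>D. (F has_real_derivative D) (at u) \<and>
    ((\<lambda>(i, j). of_nat (Suc i) * c (Suc i) j * u ^ i * v ^ j) has_sum D) UNIV"
proof -
  have s: "s > 0" using u by simp
  define a where "a i = (\<Sum>\<^sub>\<infinity>j. c i j * v ^ j)" for i
  have a: "((\<lambda>j. c i j * v ^ j) has_sum a i) UNIV" for i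
  proof -
    have "(\<lambda>j. (\<lambda>(i, j). c i j * s ^ i * v ^ j) (i, j)) summable_on UNIV"
      by (rule summable_on_SigmaD1[where A = UNIV])
        (use double_powser_summable[OF M _ v, of s] s in simp_all)
    then have "(\<lambda>j. inverse (s ^ i) * (c i j * s ^ i * v ^ j)) summable_on UNIV"
      by (intro summable_on_cmult_right) simp
    moreover have "inverse (s ^ i) * (c i j * s ^ i * v ^ j) = c i j * v ^ j" for j
      using s by simp
    ultimately show ?thesis unfolding a_def by (intro has_sum_infsum) simp
  qed
  have Fw: "(\<lambda>i. a i * w ^ i) sums F w" if w: "\<bar>w\<bar> < s" for w
  proof (rule has_sum_imp_sums, rule has_sum_SigmaD)
    show "((\<lambda>(i, j). c i j * w ^ i * v ^ j) has_sum F w) (UNIV \<times> UNIV)"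
      using F[OF w] by simp
    fix i
    show "((\<lambda>j. (\<lambda>(i, j). c i j * w ^ i * v ^ j) (i, j)) has_sum a i * w ^ i) UNIV"
      using has_sum_cmult_left[OF a[of i], of "w ^ i"] by (simp add: mult_ac)
  qed
  define D where "D = (\<Sum>n. diffs a n * u ^ n)"
  have "((\<lambda>w. \<Sum>n. a n * w ^ n) has_real_derivative D) (at u)"
    unfolding D_def by (rule termdiffs_strong'[where K = s]) (use Fw u in \<open>auto simp: sums_iff\<close>)
  then have "(F has_real_derivative D) (at u)"
  proof (rule has_field_derivative_transform_within_open)
    show "open (ball 0 s)" "u \<in> ball 0 s" using u by auto
    show "(\<Sum>n. a n * w ^ n) = F w" if "w \<in> ball 0 s" for w
      using Fw[of w] that by (simp add: sums_iff)
  qed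
  moreover have "((\<lambda>(i, j). of_nat (Suc i) * c (Suc i) j * u ^ i * v ^ j) has_sum D) UNIV"
  proof -
    let ?g = "\<lambda>(i, j). of_nat (Suc i) * c (Suc i) j * u ^ i * v ^ j"
    have g: "(?g has_sum infsum ?g UNIV) UNIV"
      using double_powser_diff_summable[OF M u v] by (rule has_sum_infsum)
    have "(\<lambda>i. diffs a i * u ^ i) sums infsum ?g UNIV"
    proof (rule has_sum_imp_sums, rule has_sum_SigmaD)
      show "(?g has_sum infsum ?g UNIV) (UNIV \<times> UNIV)" using g by simp
      fix i
      show "((\<lambda>j. ?g (i, j)) has_sum diffs a i * u ^ i) UNIV"
        using has_sum_cmult_right[OF a[of "Suc i"], of "of_nat (Suc i) * u ^ i"]
        by (simp add: mult_ac diffs_def)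
    qed
    then have "infsum ?g UNIV = D" by (simp add: D_def sums_iff)
    with g show ?thesis by simp
  qed
  ultimately show ?thesis by blast
qed

lemma open_corner:
  fixes S :: "(real \<times> real) set"
  assumes "open S" "(x0, y0) \<in> S" "e > 0"
  shows "\<exists>x y. (x, y) \<in> S \<and> 0 < \<bar>x - x0\<bar> \<and> \<bar>x - x0\<bar> = \<bar>y - y0\<bar> \<and> \<bar>x - x0\<bar> < e"
proof -
  obtain d where d: "d > 0" "ball (x0, y0) d \<subseteq> S" using assms by (meson openE)
  define s where "s = min d e / 3"
  have s: "s > 0" "s < e" "s < d / 2" using d assms by (auto simp: s_def min_def)
  have "dist (x0, y0) (x0 + s, y0 + s) \<le> \<bar>s\<bar> + \<bar>s\<bar>"
    unfolding dist_prod_def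
    by (rule order_trans[OF real_sqrt_sum_squares_triangle_ineq[of _ 0 0, simplified]])
      (simp add: dist_real_def)
  then have "(x0 + s, y0 + s) \<in> S" using d s by auto
  then show ?thesis using s by (intro exI[of _ "x0 + s"] exI[of _ "y0 + s"]) simp
qed

lemma real_analytic_on2_pdx:
  assumes f: "real_analytic_on2 f S" and S: "open S"
  shows "real_analytic_on2 (pdx f) S"
    and "(x, y) \<in> S \<Longrightarrow> ((\<lambda>t. f (t, y)) has_real_derivative pdx f (x, y)) (at x)"
proof -
  have main: "\<exists>s>0. \<exists>c. \<forall>x y. \<bar>x - x0\<bar> < s \<and> \<bar>y - y0\<bar> < s \<longrightarrow>
      ((\<lambda>t. f (t, y)) has_real_derivative pdx f (x, y)) (at x) \<and>
      ((\<lambda>(i, j). c i j * (x - x0) ^ i * (y - y0) ^ j) has_sum pdx f (x, y)) UNIV"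
    if p: "(x0, y0) \<in> S" for x0 y0
  proof -
    obtain s and c :: "nat \<Rightarrow> nat \<Rightarrow> real" where s: "s > 0"
      and M: "(\<lambda>(i, j). \<bar>c i j\<bar> * s ^ i * s ^ j) summable_on UNIV"
      and c: "\<And>x y. (x, y) \<in> S \<Longrightarrow> \<bar>x - x0\<bar> < s \<Longrightarrow> \<bar>y - y0\<bar> < s \<Longrightarrow>
        ((\<lambda>(i, j). c i j * (x - x0) ^ i * (y - y0) ^ j) has_sum f (x, y)) UNIV"
      by (rule real_analytic_on2E[OF f p open_corner[OF S p]], assumption, rule that)
    obtain d where d: "d > 0" "ball (x0, y0) d \<subseteq> S" using S p by (meson openE)
    define r where "r = min s (d / 2)"
    have r: "r > 0" "r \<le> s" using s d by (auto simp: r_def)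
    have inS: "(x, y) \<in> S" if "\<bar>x - x0\<bar> < r" "\<bar>y - y0\<bar> < r" for x y
    proof -
      have "dist (x0, y0) (x, y) \<le> \<bar>x0 - x\<bar> + \<bar>y0 - y\<bar>"
        unfolding dist_prod_def
        by (rule order_trans[OF real_sqrt_sum_squares_triangle_ineq[of _ 0 0, simplified]])
          (simp add: dist_real_def)
      also have "\<dots> < d" using that by (auto simp: r_def abs_minus_commute)
      finally show ?thesis using d(2) by auto
    qed
    have M': "(\<lambda>(i, j). \<bar>c i j\<bar> * r ^ i * r ^ j) summable_on UNIV"
    proof -
      have "(\<lambda>(i, j). \<bar>\<bar>c i j\<bar>\<bar> * s ^ i * s ^ j) summable_on UNIV" using M by simp
      then show ?thesis by (rule double_powser_summable) (use r in auto)
    qed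
    show ?thesis
    proof (intro exI[of _ r] exI[of _ "\<lambda>i j. of_nat (Suc i) * c (Suc i) j"] conjI allI impI)
      fix x y assume xy: "\<bar>x - x0\<bar> < r \<and> \<bar>y - y0\<bar> < r"
      have "\<exists>D. ((\<lambda>w. f (x0 + w, y)) has_real_derivative D) (at (x - x0)) \<and>
        ((\<lambda>(i, j). of_nat (Suc i) * c (Suc i) j * (x - x0) ^ i * (y - y0) ^ j) has_sum D) UNIV"
      proof (rule double_powser_deriv[OF M'])
        fix w assume "\<bar>w\<bar> < r"
        then show "((\<lambda>(i, j). c i j * w ^ i * (y - y0) ^ j) has_sum f (x0 + w, y)) UNIV"
          using c[OF inS, of "x0 + w" y] xy r by simp
      qed (use xy in auto)
      then obtain D where D: "((\<lambda>w. f (x0 + w, y)) has_real_derivative D) (at (x - x0))"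
        "((\<lambda>(i, j). of_nat (Suc i) * c (Suc i) j * (x - x0) ^ i * (y - y0) ^ j) has_sum D) UNIV"
        by blast
      have "((\<lambda>t. f (t, y)) has_real_derivative D) (at x)"
        using D(1) DERIV_shift[of "\<lambda>t. f (t, y)" D "x - x0" x0] by (simp add: add.commute)
      moreover from this have "pdx f (x, y) = D" by (simp add: pdx_def DERIV_imp_deriv)
      ultimately show "((\<lambda>t. f (t, y)) has_real_derivative pdx f (x, y)) (at x)"
        "((\<lambda>(i, j). of_nat (Suc i) * c (Suc i) j * (x - x0) ^ i * (y - y0) ^ j) has_sum
           pdx f (x, y)) UNIV" using D(2) by auto
    qed (fact r(1))
  qed
  show "real_analytic_on2 (pdx f) S"
    unfolding real_analytic_on2_def using main by fastforce
  show "((\<lambda>t. f (t, y)) has_real_derivative pdx f (x, y)) (at x)" if "(x, y) \<in> S"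
    using main[OF that] by force
qed

lemma real_analytic_on2_swap:
  assumes f: "real_analytic_on2 f S"
  shows "real_analytic_on2 (f \<circ> prod.swap) (prod.swap ` S)"
  unfolding real_analytic_on2_def
proof (clarsimp)
  fix x0 y0 assume p: "(x0, y0) \<in> S"
  obtain r and c :: "nat \<Rightarrow> nat \<Rightarrow> real" where r: "r > 0" and c: "\<And>x y. (x, y) \<in> S \<Longrightarrow> \<bar>x - x0\<bar> < r \<Longrightarrow> \<bar>y - y0\<bar> < r \<Longrightarrow>
      ((\<lambda>(i, j). c i j * (x - x0) ^ i * (y - y0) ^ j) has_sum f (x, y)) UNIV"
    by (rule real_analytic_on2D[OF f p], rule that)
  have "((\<lambda>(i, j). c j i * (y - y0) ^ i * (x - x0) ^ j) has_sum f (x, y)) UNIV"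
    if "(x, y) \<in> S" "\<bar>y - y0\<bar> < r" "\<bar>x - x0\<bar> < r" for x y
  proof -
    have "((\<lambda>(i, j). c i j * (x - x0) ^ i * (y - y0) ^ j) has_sum f (x, y)) (range prod.swap)"
      using c[OF that(1,3,2)] by simp
    then have "((\<lambda>(i, j). c i j * (x - x0) ^ i * (y - y0) ^ j) \<circ> prod.swap has_sum f (x, y)) UNIV"
      by (subst (asm) has_sum_reindex) auto
    also have "(\<lambda>(i, j). c i j * (x - x0) ^ i * (y - y0) ^ j) \<circ> prod.swap
      = (\<lambda>(i, j). c j i * (y - y0) ^ i * (x - x0) ^ j)" by (auto simp: mult_ac)
    finally show ?thesis .
  qed
  with r show "\<exists>r>0. \<exists>c. \<forall>(x, y)\<in>S. \<bar>y - y0\<bar> < r \<and> \<bar>x - x0\<bar> < r \<longrightarrow>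
      ((\<lambda>(i, j). c i j * (y - y0) ^ i * (x - x0) ^ j) has_sum f (x, y)) UNIV"
    by (intro exI[of _ r] conjI exI[of _ "\<lambda>i j. c j i"]) auto
qed

text \<open>Exchanging the coordinates turns statements about \<open>pdx\<close> into statements about \<open>pdy\<close>.\<close>

lemma pdy_eq_pdx_swap: "pdy f = pdx (f \<circ> prod.swap) \<circ> prod.swap"
  by (auto simp: pdy_def pdx_def)

lemma open_swap:
  fixes S :: "(real \<times> real) set"
  assumes "open S" shows "open (prod.swap ` S)"
proof -
  have "prod.swap ` S = prod.swap -` S" by force
  moreover have "continuous_on UNIV (prod.swap :: real \<times> real \<Rightarrow> _)"
    by (intro continuous_on_swap)
  ultimately show ?thesis using assms by (metis open_vimage)
qed

lemma real_analytic_on2_pdy: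
  assumes f: "real_analytic_on2 f S" and S: "open S"
  shows "real_analytic_on2 (pdy f) S"
    and "(x, y) \<in> S \<Longrightarrow> ((\<lambda>t. f (x, t)) has_real_derivative pdy f (x, y)) (at y)"
proof -
  note pdx = real_analytic_on2_pdx[OF real_analytic_on2_swap[OF f] open_swap[OF S]]
  show "real_analytic_on2 (pdy f) S"
    using real_analytic_on2_swap[OF pdx(1)] by (simp add: pdy_eq_pdx_swap image_comp)
  show "((\<lambda>t. f (x, t)) has_real_derivative pdy f (x, y)) (at y)" if "(x, y) \<in> S"
    using pdx(2)[of y x] that by (force simp: pdy_eq_pdx_swap)
qed

lemma real_analytic_on2_add:
  assumes f: "real_analytic_on2 f S" and g: "real_analytic_on2 g S"
  shows "real_analytic_on2 (\<lambda>p. f p + g p) S"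
  unfolding real_analytic_on2_def
proof (clarify)
  fix x0 y0 assume p: "(x0, y0) \<in> S"
  obtain r and c :: "nat \<Rightarrow> nat \<Rightarrow> real" where r: "r > 0" and c: "\<And>x y. (x, y) \<in> S \<Longrightarrow> \<bar>x - x0\<bar> < r \<Longrightarrow> \<bar>y - y0\<bar> < r \<Longrightarrow>
      ((\<lambda>(i, j). c i j * (x - x0) ^ i * (y - y0) ^ j) has_sum f (x, y)) UNIV"
    by (rule real_analytic_on2D[OF f p], rule that)
  obtain r' and c' :: "nat \<Rightarrow> nat \<Rightarrow> real" where r': "r' > 0" and c': "\<And>x y. (x, y) \<in> S \<Longrightarrow> \<bar>x - x0\<bar> < r' \<Longrightarrow> \<bar>y - y0\<bar> < r' \<Longrightarrow>
      ((\<lambda>(i, j). c' i j * (x - x0) ^ i * (y - y0) ^ j) has_sum g (x, y)) UNIV"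
    by (rule real_analytic_on2D[OF g p], rule that)
  have "((\<lambda>(i, j). (c i j + c' i j) * (x - x0) ^ i * (y - y0) ^ j) has_sum f (x, y) + g (x, y)) UNIV"
    if "(x, y) \<in> S" "\<bar>x - x0\<bar> < min r r'" "\<bar>y - y0\<bar> < min r r'" for x y
    using has_sum_add[OF c[of x y] c'[of x y]] that
    by (simp add: case_prod_unfold algebra_simps)
  with r r' show "\<exists>r>0. \<exists>c. \<forall>(x, y)\<in>S. \<bar>x - x0\<bar> < r \<and> \<bar>y - y0\<bar> < r \<longrightarrow>
      ((\<lambda>(i, j). c i j * (x - x0) ^ i * (y - y0) ^ j) has_sum f (x, y) + g (x, y)) UNIV"
    by (intro exI[of _ "min r r'"] conjI exI[of _ "\<lambda>i j. c i j + c' i j"]) auto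
qed

lemma real_analytic_on2_subset:
  assumes "real_analytic_on2 f S" "T \<subseteq> S"
  shows "real_analytic_on2 f T"
  unfolding real_analytic_on2_def
proof clarify
  fix x0 y0 assume "(x0, y0) \<in> T"
  with assms(2) have p: "(x0, y0) \<in> S" by blast
  obtain r and c :: "nat \<Rightarrow> nat \<Rightarrow> real" where r: "r > 0" and c: "\<And>x y. (x, y) \<in> S \<Longrightarrow> \<bar>x - x0\<bar> < r \<Longrightarrow> \<bar>y - y0\<bar> < r \<Longrightarrow>
      ((\<lambda>(i, j). c i j * (x - x0) ^ i * (y - y0) ^ j) has_sum f (x, y)) UNIV"
    by (rule real_analytic_on2D[OF assms(1) p], rule that)
  with assms(2) show "\<exists>r>0. \<exists>c. \<forall>(x, y)\<in>T. \<bar>x - x0\<bar> < r \<and> \<bar>y - y0\<bar> < r \<longrightarrow>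
      ((\<lambda>(i, j). c i j * (x - x0) ^ i * (y - y0) ^ j) has_sum f (x, y)) UNIV"
    by (intro exI[of _ r] conjI exI[of _ c]) auto
qed

lemma real_analytic_on2_row:
  assumes f: "real_analytic_on2 f S"
  shows "real_analytic_on1 (\<lambda>x. f (x, y)) {x. (x, y) \<in> S}"
  unfolding real_analytic_on1_def
proof clarify
  fix x0 assume p: "(x0, y) \<in> S"
  obtain r and c :: "nat \<Rightarrow> nat \<Rightarrow> real" where r: "r > 0" and c: "\<And>x y'. (x, y') \<in> S \<Longrightarrow> \<bar>x - x0\<bar> < r \<Longrightarrow> \<bar>y' - y\<bar> < r \<Longrightarrow>
      ((\<lambda>(i, j). c i j * (x - x0) ^ i * (y' - y) ^ j) has_sum f (x, y')) UNIV"
    by (rule real_analytic_on2D[OF f p], rule that)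
  have "(\<lambda>i. c i 0 * (x - x0) ^ i) sums f (x, y)" if x: "(x, y) \<in> S" "\<bar>x - x0\<bar> < r" for x
  proof (rule has_sum_imp_sums)
    let ?g = "\<lambda>(i, j). c i j * (x - x0) ^ i * (y - y) ^ j"
    have "(?g has_sum f (x, y)) UNIV" using c[of x y] x r by simp
    also have "?this \<longleftrightarrow> (?g has_sum f (x, y)) (range (\<lambda>i. (i, 0)))"
      by (rule has_sum_cong_neutral) auto
    also have "\<dots> \<longleftrightarrow> (?g \<circ> (\<lambda>i. (i, 0)) has_sum f (x, y)) UNIV"
      by (rule has_sum_reindex) (auto simp: inj_on_def)
    finally show "((\<lambda>i. c i 0 * (x - x0) ^ i) has_sum f (x, y)) UNIV"
      by (simp add: o_def)
  qed
  then show "\<exists>r>0. \<exists>c. \<forall>s\<in>{x. (x, y) \<in> S}. \<bar>s - x0\<bar> < r \<longrightarrow> (\<lambda>n. c n * (s - x0) ^ n) sums f (s, y)"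
    using r by (intro exI[of _ r] conjI exI[of _ "\<lambda>i. c i 0"]) auto
qed

lemma real_analytic_on2_column:
  assumes f: "real_analytic_on2 f S"
  shows "real_analytic_on1 (\<lambda>y. f (x, y)) {y. (x, y) \<in> S}"
proof -
  have "{y. (y, x) \<in> prod.swap ` S} = {y. (x, y) \<in> S}" by force
  then show ?thesis using real_analytic_on2_row[OF real_analytic_on2_swap[OF f], of x] by simp
qed

lemma real_analytic_on2_has_derivative:
  assumes f: "real_analytic_on2 f S" and S: "open S" and p: "(x, y) \<in> S"
  shows "(f has_derivative (\<lambda>(h, k). pdx f (x, y) * h + pdy f (x, y) * k)) (at (x, y))"
proof -
  obtain A B where AB: "open A" "open B" "x \<in> A" "y \<in> B" "A \<times> B \<subseteq> S"
    using open_prod_elim[OF S p] by (metis mem_Sigma_iff)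
  obtain e where e: "e > 0" "ball y e \<subseteq> B" using AB by (meson openE)
  define Y where "Y = ball y e"
  have sub: "A \<times> Y \<subseteq> S" using AB e by (auto simp: Y_def)
  have contP: "continuous_on S (pdy f)"
    by (rule real_analytic_on2_continuous[OF real_analytic_on2_pdy(1)[OF f S]])
      (rule open_corner[OF S])
  have "((\<lambda>(x, y). f (x, y)) has_derivative
      (\<lambda>(tx, ty). (*) (pdx f (x, y)) tx + blinfun_apply (blinfun_scaleR_left (pdy f (x, y))) ty))
      (at (x, y) within A \<times> Y)"
  proof (rule has_derivative_partialsI[where fy = "\<lambda>x y. blinfun_scaleR_left (pdy f (x, y))"])
    show "((\<lambda>x. f (x, y)) has_derivative (*) (pdx f (x, y))) (at x within A)"
      using real_analytic_on2_pdx(2)[OF f S p] has_field_derivative_def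
        has_field_derivative_at_within by blast
    show "((\<lambda>y'. f (x', y')) has_derivative blinfun_apply (blinfun_scaleR_left (pdy f (x', y'))))
        (at y' within Y)" if "x' \<in> A" "y' \<in> Y" for x' y'
    proof -
      have "((\<lambda>y'. f (x', y')) has_derivative (*) (pdy f (x', y'))) (at y' within Y)"
        using real_analytic_on2_pdy(2)[OF f S, of x' y'] sub that has_field_derivative_def
          has_field_derivative_at_within by blast
      moreover have "(*) (pdy f (x', y')) = blinfun_apply (blinfun_scaleR_left (pdy f (x', y')))"
        by (auto simp: blinfun_scaleR_left.rep_eq mult.commute)
      ultimately show ?thesis by simp
    qed
    have "continuous_on (A \<times> Y) (\<lambda>p. blinfun_scaleR_left (pdy f p) :: real \<Rightarrow>\<^sub>L real)"
      using continuous_on_subset[OF contP sub] by (intro continuous_intros)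
    then show "continuous (at (x, y) within A \<times> Y)
        (\<lambda>(x, y). blinfun_scaleR_left (pdy f (x, y)) :: real \<Rightarrow>\<^sub>L real)"
      using AB e unfolding continuous_on_eq_continuous_within
      by (auto simp: Y_def case_prod_unfold)
  qed (use AB e in \<open>auto simp: Y_def\<close>)
  then have "(f has_derivative (\<lambda>(h, k). pdx f (x, y) * h + pdy f (x, y) * k)) 
      (at (x, y) within A \<times> Y)"
    by (simp add: blinfun_scaleR_left.rep_eq mult.commute case_prod_unfold)
  moreover have "open (A \<times> Y)" "(x, y) \<in> A \<times> Y"
    using AB e by (auto simp: Y_def open_Times)
  ultimately show ?thesis by (metis at_within_open)
qed

section \<open>The interval, the strip and the shear flow\<close>

lemma deriv_I_eq:
  assumes "(f has_real_derivative D) (at t within {-1..1})" "t \<in> {-1..1}"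
  shows "deriv_I f t = D"
  unfolding deriv_I_def
  using assms vector_derivative_within_closed_interval[of "-1" 1 t f D]
  by (simp add: has_real_derivative_iff_has_vector_derivative)

lemma islimpt_unit_interval: "t \<in> {-1..1} \<Longrightarrow> t islimpt {-1..1::real}"
  by (simp add: islimpt_Icc)

lemma hol_ext_on_deriv_I:
  assumes "hol_ext_on f {-1..1}"
  shows "t \<in> {-1..1} \<Longrightarrow> (f has_real_derivative deriv_I f t) (at t within {-1..1})"
    and "hol_ext_on (deriv_I f) {-1..1}"
proof -
  show *: "(f has_real_derivative deriv_I f t) (at t within {-1..1})" if "t \<in> {-1..1}" for t
    using hol_ext_on_has_derivative[OF assms that] deriv_I_eq[OF _ that] by metis
  show "hol_ext_on (deriv_I f) {-1..1}"
    using hol_ext_on_derivative[OF assms islimpt_unit_interval *] by blast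
qed

lemma deriv_I_interior:
  assumes "(f has_real_derivative D) (at t)" "t \<in> {-1<..<1}"
  shows "deriv_I f t = D"
  using assms by (intro deriv_I_eq) (auto intro: has_field_derivative_at_within)

text \<open>The supremum of an unbounded set of reals carries no information, so the point is boundedness:
the one-sided derivatives of a function that is analytic up to the endpoints are continuous on the
compact interval.\<close>

lemma abs_le_C2_norm:
  assumes f: "hol_ext_on f {-1..1}" and k: "k \<le> 2" and t: "t \<in> {-1..1}"
  shows "\<bar>(deriv_I ^^ k) f t\<bar> \<le> C2_norm f"
proof -
  let ?S = "\<lambda>k. SUP t\<in>{-1..1}. \<bar>(deriv_I ^^ k) f t\<bar>"
  have "hol_ext_on ((deriv_I ^^ k) f) {-1..1}" for k
    by (induction k) (auto simp: f intro: hol_ext_on_deriv_I(2))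
  then have "continuous_on {-1..1} (\<lambda>t. \<bar>(deriv_I ^^ k) f t\<bar>)" for k
    by (intro continuous_intros hol_ext_on_continuous)
  then have "compact ((\<lambda>t. \<bar>(deriv_I ^^ k) f t\<bar>) ` {-1..1})" for k
    by (intro compact_continuous_image) auto
  then have bdd: "bdd_above ((\<lambda>t. \<bar>(deriv_I ^^ k) f t\<bar>) ` {-1..1})" for k
    by (intro bounded_imp_bdd_above compact_imp_bounded)
  have le: "\<bar>(deriv_I ^^ k) f s\<bar> \<le> ?S k" if "s \<in> {-1..1}" for k s
    using that by (intro cSUP_upper bdd)
  have "0 \<le> ?S k" for k using le[of 0 k] by fastforce
  then have "?S k \<le> C2_norm f"
    unfolding C2_norm_def using k by (intro member_le_sum) auto
  with le[OF t, of k] show ?thesis by linarith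
qed

lemma C2_norm_eq_0:
  assumes "\<And>t. t \<in> {-1..1} \<Longrightarrow> f t = 0"
  shows "C2_norm f = 0"
proof -
  have "\<forall>t\<in>{-1..1}. (deriv_I ^^ k) f t = 0" for k
  proof (induction k)
    case (Suc k)
    show ?case
    proof
      fix t :: real assume t: "t \<in> {-1..1}"
      have "((\<lambda>x. 0) has_real_derivative 0) (at t within {-1..1})" by simp
      then have "((deriv_I ^^ k) f has_real_derivative 0) (at t within {-1..1})"
        by (rule has_field_derivative_transform_within[OF _ zero_less_one t]) (use Suc in simp)
      then show "(deriv_I ^^ Suc k) f t = 0" using t by (simp add: deriv_I_eq)
    qed
  qed (use assms in simp)
  then have "(SUP t\<in>{-1..1}. \<bar>(deriv_I ^^ k) f t\<bar>) = (SUP t\<in>{-1..1::real}. 0)" for k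
    by (intro SUP_cong) auto
  then show ?thesis unfolding C2_norm_def by simp
qed

lemma open_strip: "open strip"
  unfolding strip_def by (intro open_Times) auto

lemma mem_strip: "(x, y) \<in> strip \<longleftrightarrow> y \<in> {-1<..<1}"
  by (simp add: strip_def)

lemma mem_cstrip: "(x, y) \<in> cstrip \<longleftrightarrow> y \<in> {-1..1}"
  by (simp add: cstrip_def)

lemma cstrip_corner:
  assumes "(x0, y0) \<in> cstrip" "e > 0"
  shows "\<exists>x y. (x, y) \<in> cstrip \<and> 0 < \<bar>x - x0\<bar> \<and> \<bar>x - x0\<bar> = \<bar>y - y0\<bar> \<and> \<bar>x - x0\<bar> < e"
proof -
  \<comment> \<open>The vertical displacement points towards the centre line, so that it stays in the strip.\<close>
  define d where "d = min 1 (e / 2)"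
  have d: "d > 0" "d \<le> 1" "d < e" using assms by (auto simp: d_def)
  define y where "y = (if y0 \<le> 0 then y0 + d else y0 - d)"
  have "(x0 + d, y) \<in> cstrip" "\<bar>y - y0\<bar> = d"
    using assms d by (auto simp: mem_cstrip y_def)
  then show ?thesis using d by (intro exI[of _ "x0 + d"] exI[of _ y]) simp
qed

lemma shear_flow_analytic:
  assumes \<phi>: "real_analytic_on1 \<phi> {-1..1}"
  shows "real_analytic_on2 (shear_flow \<phi>) cstrip"
  unfolding real_analytic_on2_def
proof clarify
  fix x0 y0 assume p: "(x0, y0) \<in> cstrip"
  then have y0: "y0 \<in> {-1..1}" by (simp add: mem_cstrip)
  obtain r c where r: "r > 0"
    and c: "\<And>s. s \<in> {-1..1} \<Longrightarrow> \<bar>s - y0\<bar> < r \<Longrightarrow> (\<lambda>n. c n * (s - y0) ^ n) sums \<phi> s"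
    using \<phi> y0 unfolding real_analytic_on1_def by meson
  define d where "d = min 1 (r / 2)"
  have d: "d > 0" "d < r" "d \<le> 1" using r by (auto simp: d_def)
  define y1 where "y1 = (if y0 \<le> 0 then y0 + d else y0 - d)"
  have y1: "y1 \<in> {-1..1}" "\<bar>y1 - y0\<bar> = d" using y0 d by (auto simp: y1_def)
  \<comment> \<open>Convergence at \<open>y1\<close>, at distance \<open>d\<close> from \<open>y0\<close>, gives absolute convergence closer in.\<close>
  have sm: "summable (\<lambda>n. c n * (y1 - y0) ^ n)"
    using c[OF y1(1)] y1 d by (simp add: sums_iff)
  define C where "C = (\<lambda>i j. if i = (0::nat) then c j else 0)"
  have "((\<lambda>(i, j). C i j * (x - x0) ^ i * (y - y0) ^ j) has_sum shear_flow \<phi> (x, y)) UNIV"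
    if xy: "(x, y) \<in> cstrip" "\<bar>y - y0\<bar> < d" for x y
  proof -
    let ?g = "\<lambda>(i, j). C i j * (x - x0) ^ i * (y - y0) ^ j"
    have "summable (\<lambda>n. norm (c n * (y - y0) ^ n))"
      using sm by (rule powser_insidea) (use xy y1 in simp)
    moreover have "(\<lambda>n. c n * (y - y0) ^ n) sums \<phi> y"
      using c[of y] xy d by (simp add: mem_cstrip)
    ultimately have "((\<lambda>n. c n * (y - y0) ^ n) has_sum \<phi> y) UNIV"
      by (rule norm_summable_imp_has_sum)
    then have "(?g \<circ> (\<lambda>j. (0, j)) has_sum \<phi> y) UNIV" by (simp add: o_def C_def)
    then have "(?g has_sum \<phi> y) (range (\<lambda>j. (0, j)))"
      by (subst has_sum_reindex) (auto simp: inj_on_def)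
    also have "?this \<longleftrightarrow> (?g has_sum \<phi> y) UNIV"
      by (rule has_sum_cong_neutral) (auto simp: C_def)
    finally show ?thesis using xy by (simp add: shear_flow_def)
  qed
  then show "\<exists>r>0. \<exists>c. \<forall>(x, y)\<in>cstrip. \<bar>x - x0\<bar> < r \<and> \<bar>y - y0\<bar> < r \<longrightarrow>
      ((\<lambda>(i, j). c i j * (x - x0) ^ i * (y - y0) ^ j) has_sum shear_flow \<phi> (x, y)) UNIV"
    using d(1) by (intro exI[of _ d] conjI exI[of _ C]) auto
qed

lemma pdx_row_independent:
  assumes "\<And>x. f (x, y) = f (0, y)"
  shows "pdx f (x, y) = 0"
proof -
  have "(\<lambda>s. f (s, y)) = (\<lambda>s. f (0, y))" using assms by blast
  then show ?thesis by (simp add: pdx_def)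
qed

text \<open>A function of \<open>y\<close> alone has \<open>pdx\<close> zero, and so has its Laplacian; both terms of the Euler
equation therefore vanish.\<close>

lemma shear_flow_in_steady_class:
  assumes \<phi>: "real_analytic_on1 \<phi> {-1..1}"
  shows "shear_flow \<phi> \<in> steady_class \<phi>"
proof -
  let ?\<psi> = "shear_flow \<phi>"
  have row: "?\<psi> (x, y) = ?\<psi> (0, y)" for x y
    by (simp add: shear_flow_def cstrip_def)
  have px: "pdx ?\<psi> (x, y) = 0" for x y
    by (rule pdx_row_independent) (rule row)
  have "laplacian ?\<psi> (x, y) = laplacian ?\<psi> (0, y)" for x y
  proof -
    have "pdx (pdx ?\<psi>) (x', y) = 0" for x' by (rule pdx_row_independent) (simp add: px)
    moreover have "(\<lambda>s. ?\<psi> (x, s)) = (\<lambda>s. ?\<psi> (0, s))" using row by blast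
    then have "pdy (pdy ?\<psi>) (x, y) = pdy (pdy ?\<psi>) (0, y)" by (simp add: pdy_def)
    ultimately show ?thesis by (simp add: laplacian_def)
  qed
  then have "pdx (laplacian ?\<psi>) (x, y) = 0" for x y by (rule pdx_row_independent)
  then have "perp_grad ?\<psi> p \<bullet> grad (laplacian ?\<psi>) p = 0" for p
    by (cases p) (simp add: perp_grad_def grad_def px)
  moreover have "C2_norm (\<lambda>y. ?\<psi> (x, y) - \<phi> y) = 0" for x
    by (rule C2_norm_eq_0) (simp add: shear_flow_def mem_cstrip)
  moreover have "?\<psi> \<in> extensional cstrip" by (simp add: shear_flow_def)
  ultimately show ?thesis
    using shear_flow_analytic[OF \<phi>] by (simp add: steady_class_def shear_flow_def mem_cstrip)
qed

section \<open>Vorticity near infinity\<close>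

text \<open>The second difference \<open>f (x + 2) - 2 * f (x + 1) + f x\<close> tends to \<open>0\<close>, and by two applications of
the mean value theorem it is a value of \<open>f''\<close> at a point beyond \<open>x\<close>. This recovers the
\<open>x\<close>-derivatives, about which convergence of the vertical profiles alone says nothing.\<close>

lemma limit_second_derivative_zero:
  fixes f :: "real \<Rightarrow> real"
  assumes f: "(f \<longlongrightarrow> l) at_top"
    and f1: "\<And>x. x > R \<Longrightarrow> (f has_real_derivative f' x) (at x)"
    and f2: "\<And>x. x > R \<Longrightarrow> (f' has_real_derivative f'' x) (at x)"
    and lim: "(f'' \<longlongrightarrow> L) at_top"
  shows "L = 0"
proof -
  define g where "g x = f (x + 2) - 2 * f (x + 1) + f x" for x
  have shift: "((\<lambda>x. f (x + c)) \<longlongrightarrow> l) at_top" for c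
    using f by (rule filterlim_compose)
      (rule filterlim_tendsto_add_at_top[OF tendsto_const filterlim_ident,
         of c, simplified add.commute])
  have "(g \<longlongrightarrow> l - 2 * l + l) at_top"
    unfolding g_def using f by (intro tendsto_intros shift)
  then have g0: "(g \<longlongrightarrow> 0) at_top" by simp
  have ev: "\<exists>z>x. g x = f'' z" if x: "x > R" for x
  proof -
    have "\<exists>z. x < z \<and> z < x + 1 \<and> (f (x + 1 + 1) - f (x + 1)) - (f (x + 1) - f x)
        = (x + 1 - x) * (f' (z + 1) - f' z)"
    proof (rule MVT2)
      fix z assume z: "x \<le> z" "z \<le> x + 1"
      show "((\<lambda>x. f (x + 1) - f x) has_real_derivative f' (z + 1) - f' z) (at z)"
        using f1[of z] f1[of "z + 1"] x z
        by (intro DERIV_diff) (auto simp: DERIV_shift)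
    qed simp
    then obtain z where z: "x < z" "g x = f' (z + 1) - f' z"
      by (auto simp: g_def add.assoc)
    have "\<exists>w. z < w \<and> w < z + 1 \<and> f' (z + 1) - f' z = (z + 1 - z) * f'' w"
      by (rule MVT2) (use f2 x z in auto)
    then obtain w where "z < w" "g x = f'' w" using z by auto
    then show ?thesis using z by (meson order_less_trans)
  qed
  have "(g \<longlongrightarrow> L) at_top"
  proof (rule tendstoI)
    fix e :: real assume "e > 0"
    then have "\<forall>\<^sub>F x in at_top. dist (f'' x) L < e" using lim by (rule tendstoD[rotated])
    then obtain N where N: "\<And>x. x \<ge> N \<Longrightarrow> dist (f'' x) L < e"
      by (auto simp: eventually_at_top_linorder)
    have "dist (g x) L < e" if "x > max R N" for x
      using ev[of x] N that by auto
    then show "\<forall>\<^sub>F x in at_top. dist (g x) L < e"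
      by (meson eventually_at_top_dense)
  qed
  with g0 show ?thesis using tendsto_unique trivial_limit_at_top_linorder by blast
qed

text \<open>Where \<open>pdy \<psi>\<close> is positive, the level curves of \<open>\<psi>\<close> are graphs over the \<open>x\<close>-axis, so
\<open>T (x, y) = (x, \<psi> (x, y))\<close> is a change of coordinates onto a product of intervals. In the new
coordinates the Euler equation says that the \<open>x\<close>-derivative of \<open>\<omega>\<close> is zero.\<close>

lemma constant_along_level_curves:
  fixes \<psi> \<omega> :: "real \<times> real \<Rightarrow> real"
  assumes \<psi>: "real_analytic_on2 \<psi> strip" and \<omega>: "real_analytic_on2 \<omega> strip"
    and cont: "continuous_on cstrip \<psi>"
    and euler: "\<And>x y. x > R \<Longrightarrow> y \<in> {-1<..<1} \<Longrightarrow>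
        pdx \<psi> (x, y) * pdy \<omega> (x, y) = pdy \<psi> (x, y) * pdx \<omega> (x, y)"
    and bdry: "\<And>x. \<psi> (x, -1) = c0" "\<And>x. \<psi> (x, 1) = c1"
    and pos: "\<And>x y. x > R \<Longrightarrow> y \<in> {-1<..<1} \<Longrightarrow> pdy \<psi> (x, y) > 0"
  obtains G where "continuous_on {c0<..<c1} G"
    "\<And>x y. x > R \<Longrightarrow> y \<in> {-1<..<1} \<Longrightarrow>
        \<psi> (x, y) \<in> {c0<..<c1} \<and> \<omega> (x, y) = G (\<psi> (x, y))"
proof -
  define U where "U = {R<..} \<times> {-1<..<1::real}"
  define T where "T = (\<lambda>(x, y). (x, \<psi> (x, y)))"
  define g where "g = inv_into U T"
  have U: "open U" "U \<subseteq> strip" by (auto simp: U_def strip_def intro: open_Times)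
  have cont_col: "continuous_on {-1..1} (\<lambda>y. \<psi> (x, y))" for x
    by (rule continuous_on_compose2[OF cont]) (auto simp: mem_cstrip intro!: continuous_intros)
  have mono: "\<psi> (x, y) < \<psi> (x, y')" if "x > R" "-1 \<le> y" "y < y'" "y' \<le> 1" for x y y'
  proof (rule DERIV_pos_imp_increasing_open[OF that(3)])
    fix t assume t: "y < t" "t < y'"
    then have "((\<lambda>t. \<psi> (x, t)) has_real_derivative pdy \<psi> (x, t)) (at t)"
      using that by (intro real_analytic_on2_pdy(2)[OF \<psi> open_strip]) (simp add: mem_strip)
    moreover have "pdy \<psi> (x, t) > 0" using t that by (intro pos) auto
    ultimately show "\<exists>d. ((\<lambda>t. \<psi> (x, t)) has_real_derivative d) (at t) \<and> 0 < d" by blast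
  next
    show "continuous_on {y..y'} (\<lambda>t. \<psi> (x, t))"
      by (rule continuous_on_subset[OF cont_col]) (use that in auto)
  qed
  have range: "\<psi> (x, y) \<in> {c0<..<c1}" if "x > R" "y \<in> {-1<..<1}" for x y
    using mono[of x "-1" y] mono[of x y 1] that bdry by auto
  have inj: "inj_on T U"
  proof (rule inj_onI)
    fix p q assume pq: "p \<in> U" "q \<in> U" "T p = T q"
    obtain x y x' y' where "p = (x, y)" "q = (x', y')" by fastforce
    with pq mono[of x y y'] mono[of x y' y] show "p = q"
      by (cases y y' rule: linorder_cases) (auto simp: T_def U_def)
  qed
  have surj: "(x, c) \<in> T ` U" if xc: "x > R" "c \<in> {c0<..<c1}" for x c
  proof -
    have "\<exists>y\<ge>-1. y \<le> 1 \<and> \<psi> (x, y) = c"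
      by (rule IVT') (use xc bdry cont_col in auto)
    then obtain y where y: "-1 \<le> y" "y \<le> 1" "\<psi> (x, y) = c" by blast
    then have "y \<noteq> -1" "y \<noteq> 1" using xc bdry by auto
    then show ?thesis using xc y
      by (intro image_eqI[of _ _ "(x, y)"]) (auto simp: T_def U_def)
  qed
  have gT: "g (T p) = p" if "p \<in> U" for p
    unfolding g_def using inj that by (rule inv_into_f_f)
  have contT: "continuous_on U T"
  proof -
    have "continuous_on U \<psi>"
      by (rule continuous_on_subset[OF cont]) (auto simp: U_def mem_cstrip)
    then have "continuous_on U (\<lambda>p. (fst p, \<psi> p))" by (intro continuous_intros)
    then show ?thesis by (simp add: T_def case_prod_unfold)
  qed
  have W: "\<exists>k. ((\<lambda>q. \<omega> (g q)) has_derivative (\<lambda>(h1, h2). k * h2)) (at (x, c))"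
    if xc: "x > R" "c \<in> {c0<..<c1}" for x c
  proof -
    obtain y where y: "(x, y) \<in> U" "(x, c) = T (x, y)"
      using surj[OF xc] by (auto simp: T_def)
    then have xy: "(x, y) \<in> strip" "y \<in> {-1<..<1}" "pdy \<psi> (x, y) > 0"
      using pos by (auto simp: mem_strip U_def)
    define \<psi>x \<psi>y \<omega>x \<omega>y where "\<psi>x = pdx \<psi> (x, y)" "\<psi>y = pdy \<psi> (x, y)"
        "\<omega>x = pdx \<omega> (x, y)" "\<omega>y = pdy \<omega> (x, y)"
    note d = this
    have "((\<lambda>p. (fst p, \<psi> p)) has_derivative (\<lambda>h. (fst h, \<psi>x * fst h + \<psi>y * snd h))) (at (x, y))"
      using real_analytic_on2_has_derivative[OF \<psi> open_strip xy(1)]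
      by (intro has_derivative_Pair) (auto intro!: derivative_eq_intros simp: d case_prod_unfold)
    then have T': "(T has_derivative (\<lambda>h. (fst h, \<psi>x * fst h + \<psi>y * snd h))) (at (x, y))"
      by (simp add: T_def case_prod_unfold)
    have "(g has_derivative (\<lambda>k. (fst k, (snd k - \<psi>x * fst k) / \<psi>y))) (at (T (x, y)))"
      by (rule has_derivative_inverse_strong[OF U(1) y(1) contT gT T'])
        (use xy in \<open>auto simp: d\<close>)
    then have g': "(g has_derivative (\<lambda>k. (fst k, (snd k - \<psi>x * fst k) / \<psi>y))) (at (x, c))"
      by (simp add: y(2))
    have "g (x, c) = (x, y)" using gT[OF y(1)] y(2) by simp
    then have "(\<omega> has_derivative (\<lambda>h. \<omega>x * fst h + \<omega>y * snd h)) (at (g (x, c)))"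
      using real_analytic_on2_has_derivative[OF \<omega> open_strip xy(1)]
      by (simp add: d case_prod_unfold)
    from has_derivative_compose[OF g' this]
    have "((\<lambda>q. \<omega> (g q)) has_derivative
        (\<lambda>k. \<omega>x * fst k + \<omega>y * ((snd k - \<psi>x * fst k) / \<psi>y))) (at (x, c))"
      by simp
    moreover have "\<omega>x * fst k + \<omega>y * ((snd k - \<psi>x * fst k) / \<psi>y) = \<omega>y / \<psi>y * snd k" for k
    proof -
      have "\<psi>x * \<omega>y = \<psi>y * \<omega>x" using euler[of x y] xc xy by (simp add: d)
      then have "\<omega>y * (\<psi>x * fst k) = \<psi>y * \<omega>x * fst k" by (simp add: mult_ac)
      then show ?thesis using xy(3) by (auto simp: d(2) field_simps)
    qed
    ultimately show ?thesis by (intro exI[of _ "\<omega>y / \<psi>y"]) (simp add: case_prod_unfold)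
  qed
  define G where "G c = \<omega> (g (R + 1, c))" for c
  have const: "\<omega> (g (x, c)) = G c" if xc: "x > R" "c \<in> {c0<..<c1}" for x c
  proof -
    have "((\<lambda>t. \<omega> (g (t, c))) has_real_derivative 0) (at t within {R<..})" if t: "t \<in> {R<..}" for t
    proof -
      obtain k where k: "((\<lambda>q. \<omega> (g q)) has_derivative (\<lambda>(h1, h2). k * h2)) (at (t, c))"
        using W[of t c] t xc by auto
      have "((\<lambda>t. (t, c)) has_derivative (\<lambda>h. (h, 0))) (at t)"
        by (auto intro!: derivative_eq_intros)
      from has_derivative_compose[OF this k]
      have "((\<lambda>t. \<omega> (g (t, c))) has_derivative (\<lambda>h. 0)) (at t)" by simp
      then have "((\<lambda>t. \<omega> (g (t, c))) has_real_derivative 0) (at t)"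
        by (simp add: has_field_derivative_def lambda_zero)
      then show ?thesis by (rule has_field_derivative_at_within)
    qed
    with has_field_derivative_zero_constant[OF convex_real_interval(3)]
    have "\<exists>C. \<forall>t\<in>{R<..}. \<omega> (g (t, c)) = C" by blast
    then show ?thesis using xc by (auto simp: G_def)
  qed
  show ?thesis
  proof (rule that)
    show "continuous_on {c0<..<c1} G"
      unfolding continuous_on_eq_continuous_within
    proof
      fix c assume c: "c \<in> {c0<..<c1}"
      have "isCont (\<lambda>q. \<omega> (g q)) (R + 1, c)"
        using W[of "R + 1" c] c has_derivative_continuous by auto
      moreover have "isCont (\<lambda>c. (R + 1, c)) c" by (intro continuous_intros)
      ultimately have "isCont G c" unfolding G_def using isCont_o2 by fast
      then show "continuous (at c within {c0<..<c1}) G" by (rule continuous_at_imp_continuous_at_within)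
    qed
    fix x y assume xy: "x > R" "y \<in> {-1<..<1::real}"
    then have "g (x, \<psi> (x, y)) = (x, y)" using gT[of "(x, y)"] by (auto simp: T_def U_def)
    then show "\<psi> (x, y) \<in> {c0<..<c1} \<and> \<omega> (x, y) = G (\<psi> (x, y))"
      using const[OF xy(1) range[OF xy]] range[OF xy] by simp
  qed
qed

section \<open>A maximum principle on the strip\<close>

lemma DERIV_second_local_max:
  fixes f :: "real \<Rightarrow> real"
  assumes e: "e > 0" and f': "\<And>s. \<bar>s - t\<bar> < e \<Longrightarrow> (f has_real_derivative f' s) (at s)"
    and f'': "(f' has_real_derivative D) (at t)"
    and max: "\<And>s. \<bar>s - t\<bar> < e \<Longrightarrow> f s \<le> f t"
  shows "f' t = 0" "D \<le> 0"
proof -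
  show 0: "f' t = 0"
    by (rule DERIV_local_max[OF f' e]) (use e max in \<open>auto simp: abs_minus_commute\<close>)
  show "D \<le> 0"
  proof (rule ccontr)
    assume "\<not> D \<le> 0"
    then obtain d where d: "d > 0" "\<And>h. 0 < h \<Longrightarrow> h < d \<Longrightarrow> f' t < f' (t + h)"
      using DERIV_pos_inc_right[OF f''] by force
    define s where "s = t + min d e / 2"
    have s: "t < s" "s - t < d" "s - t < e" using d e by (auto simp: s_def min_def)
    have "f t < f s"
    proof (rule DERIV_pos_imp_increasing_open[OF s(1)])
      fix z assume z: "t < z" "z < s"
      then have "f' t < f' z" using d(2)[of "z - t"] s by simp
      with 0 show "\<exists>y. (f has_real_derivative y) (at z) \<and> 0 < y"
        using f'[of z] z s by auto
    next
      have "isCont f z" if "z \<in> {t..s}" for z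
        using f'[of z] that s by (intro DERIV_isCont) auto
      then show "continuous_on {t..s} f" by (simp add: continuous_at_imp_continuous_on)
    qed
    moreover have "f s \<le> f t" using s by (intro max) auto
    ultimately show False by simp
  qed
qed

text \<open>Suppose \<open>g\<close> has a positive value. Adding a small multiple of \<open>exp (l * y)\<close> keeps the maximum over a
large rectangle in the interior, and at the maximum point it determines the gradient of \<open>g\<close>:
\<open>gx = 0\<close> and \<open>gy = - w\<close> with \<open>w = \<epsilon> * l * exp (l * y)\<close> at most \<open>1\<close>. The second derivative test
gives \<open>l * w \<le> - (gxx + gyy)\<close>, while the differential inequality bounds the right-hand side by
\<open>3 * \<bar>K\<bar> * w\<close>, so \<open>l = 3 * \<bar>K\<bar> + 1\<close> is contradictory. The term quadratic in the
gradient is harmless because the gradient is small at the point where the inequality is used.\<close>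

lemma strip_max_principle:
  fixes g gx gy gxx gyy :: "real \<times> real \<Rightarrow> real"
  assumes cont: "continuous_on cstrip g"
    and bdry: "\<And>x. g (x, -1) = 0" "\<And>x. g (x, 1) = 0"
    and inf: "\<And>\<delta>. \<delta> > 0 \<Longrightarrow> \<exists>R. \<forall>x y. \<bar>x\<bar> \<ge> R \<longrightarrow> y \<in> {-1..1} \<longrightarrow> g (x, y) \<le> \<delta>"
    and gx: "\<And>x y. y \<in> {-1<..<1} \<Longrightarrow> ((\<lambda>t. g (t, y)) has_real_derivative gx (x, y)) (at x)"
    and gy: "\<And>x y. y \<in> {-1<..<1} \<Longrightarrow> ((\<lambda>t. g (x, t)) has_real_derivative gy (x, y)) (at y)"
    and gxx: "\<And>x y. y \<in> {-1<..<1} \<Longrightarrow> ((\<lambda>t. gx (t, y)) has_real_derivative gxx (x, y)) (at x)"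
    and gyy: "\<And>x y. y \<in> {-1<..<1} \<Longrightarrow> ((\<lambda>t. gy (x, t)) has_real_derivative gyy (x, y)) (at y)"
    and ineq: "\<And>x y. y \<in> {-1<..<1} \<Longrightarrow>
        \<bar>gxx (x, y) + gyy (x, y)\<bar> \<le> K * ((gx (x, y))\<^sup>2 + (gy (x, y))\<^sup>2 + 2 * \<bar>gy (x, y)\<bar>)"
    and y: "y \<in> {-1..1}"
  shows "g (x, y) \<le> 0"
proof (rule ccontr)
  define m where "m = g (x, y)"
  assume "\<not> g (x, y) \<le> 0"
  then have m: "m > 0" by (simp add: m_def)
  define l where "l = 3 * \<bar>K\<bar> + 1"
  have l: "l > 0" by (simp add: l_def)
  \<comment> \<open>The first bound excludes a maximum on the boundary, the second one gives \<open>w \<le> 1\<close>.\<close>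
  define \<epsilon> where "\<epsilon> = min (m / 3) (1 / l) / exp l"
  have \<epsilon>: "\<epsilon> > 0" "\<epsilon> * exp l \<le> m / 3" "\<epsilon> * exp l \<le> 1 / l"
    using m l by (auto simp: \<epsilon>_def)
  obtain R0 where R0: "\<And>x y. \<bar>x\<bar> \<ge> R0 \<Longrightarrow> y \<in> {-1..1} \<Longrightarrow> g (x, y) \<le> m / 3"
    using inf[of "m / 3"] m by auto
  define R where "R = max \<bar>x\<bar> R0"
  define Q where "Q = {-R..R} \<times> {-1..1::real}"
  define u where "u p = g p + \<epsilon> * exp (l * snd p)" for p
  have "compact Q" unfolding Q_def by (intro compact_Times) auto
  moreover have xyQ: "(x, y) \<in> Q" using y by (auto simp: Q_def R_def)
  moreover have "continuous_on Q u"
    unfolding u_def by (intro continuous_intros continuous_on_subset[OF cont])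
      (auto simp: Q_def mem_cstrip)
  ultimately obtain q where q: "q \<in> Q" "\<And>p. p \<in> Q \<Longrightarrow> u p \<le> u q"
    using continuous_attains_sup[of Q u] by (metis empty_iff)
  obtain x1 y1 where q1: "q = (x1, y1)" by fastforce
  have y1: "y1 \<in> {-1..1}" "\<bar>x1\<bar> \<le> R" using q(1) by (auto simp: q1 Q_def)
  define E where "E = exp (l * y1)"
  have E: "E > 0" "E \<le> exp l" using y1 l by (auto simp: E_def mult_left_le)
  have "m < u (x, y)" using \<epsilon>(1) by (simp add: u_def m_def)
  also have "\<dots> \<le> g (x1, y1) + \<epsilon> * E" using q(2)[OF xyQ] by (simp add: u_def q1 E_def)
  also have "\<dots> \<le> g (x1, y1) + m / 3"
    using order_trans[OF mult_left_mono[OF E(2)] \<epsilon>(2)] \<epsilon>(1) by simp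
  finally have big: "g (x1, y1) > 2 * m / 3" by simp
  have "y1 \<noteq> 1" "y1 \<noteq> -1" using big m bdry by auto
  then have y1': "y1 \<in> {-1<..<1}" using y1 by auto
  have "\<not> \<bar>x1\<bar> \<ge> R0" using R0[of x1 y1] big m y1 by auto
  then have x1: "\<bar>x1\<bar> < R" using y1(2) by (simp add: R_def)
  have X: "gx (x1, y1) = 0" "gxx (x1, y1) \<le> 0"
  proof -
    have e: "R - \<bar>x1\<bar> > 0" using x1 by simp
    have "g (s, y1) \<le> g (x1, y1)" if "\<bar>s - x1\<bar> < R - \<bar>x1\<bar>" for s
    proof -
      have "s \<in> {-R..R}" using that by (simp, linarith)
      then show ?thesis using q(2)[of "(s, y1)"] y1 by (auto simp: Q_def q1 u_def)
    qed
    from DERIV_second_local_max[OF e gx[OF y1'] gxx[OF y1'] this]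
    show "gx (x1, y1) = 0" "gxx (x1, y1) \<le> 0" by auto
  qed
  have Y: "gy (x1, y1) + \<epsilon> * (l * E) = 0" "gyy (x1, y1) + \<epsilon> * (l * (l * E)) \<le> 0"
  proof -
    have e: "1 - \<bar>y1\<bar> > 0" using y1' by auto
    have in1: "s \<in> {-1<..<1}" if "\<bar>s - y1\<bar> < 1 - \<bar>y1\<bar>" for s using that by auto
    have 1: "((\<lambda>t. u (x1, t)) has_real_derivative gy (x1, s) + \<epsilon> * (l * exp (l * s))) (at s)"
      if "\<bar>s - y1\<bar> < 1 - \<bar>y1\<bar>" for s
      unfolding u_def by (auto intro!: derivative_eq_intros gy in1 that)
    have 2: "((\<lambda>s. gy (x1, s) + \<epsilon> * (l * exp (l * s))) has_real_derivative
        gyy (x1, y1) + \<epsilon> * (l * (l * exp (l * y1)))) (at y1)"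
      by (auto intro!: derivative_eq_intros gyy y1')
    have "u (x1, s) \<le> u (x1, y1)" if "\<bar>s - y1\<bar> < 1 - \<bar>y1\<bar>" for s
      using q(2)[of "(x1, s)"] in1[OF that] x1 by (auto simp: Q_def q1 abs_less_iff)
    from DERIV_second_local_max[OF e 1 2 this]
    show "gy (x1, y1) + \<epsilon> * (l * E) = 0" "gyy (x1, y1) + \<epsilon> * (l * (l * E)) \<le> 0"
      by (auto simp: E_def)
  qed
  define w where "w = \<epsilon> * l * E"
  have w: "w > 0" "w \<le> 1"
  proof -
    show "w > 0" using \<epsilon> l E by (simp add: w_def)
    have "w \<le> \<epsilon> * l * exp l" using E \<epsilon> l by (simp add: w_def)
    also have "\<dots> \<le> 1" using \<epsilon>(3) l by (simp add: field_simps)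
    finally show "w \<le> 1" .
  qed
  have "l * w \<le> \<bar>gxx (x1, y1) + gyy (x1, y1)\<bar>"
    using X(2) Y(2) by (simp add: w_def mult_ac)
  also have "\<dots> \<le> K * ((gx (x1, y1))\<^sup>2 + (gy (x1, y1))\<^sup>2 + 2 * \<bar>gy (x1, y1)\<bar>)"
    by (rule ineq[OF y1'])
  also have "gy (x1, y1) = - w" using Y(1) by (simp add: w_def mult_ac)
  also have "K * ((gx (x1, y1))\<^sup>2 + (- w)\<^sup>2 + 2 * \<bar>- w\<bar>) = K * (w + 2) * w"
    using X(1) w by (simp add: power2_eq_square algebra_simps)
  also have "\<dots> \<le> (\<bar>K\<bar> * 3) * w"
    using w by (intro mult_right_mono mult_mono) auto
  finally have "l \<le> \<bar>K\<bar> * 3" using w by simp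
  then show False by (simp add: l_def)
qed

section \<open>The semilinear equation on the strip\<close>

lemma inverse_DERIV:
  fixes f :: "real \<Rightarrow> real"
  assumes S: "open S" "t \<in> S" and g: "\<And>s. s \<in> S \<Longrightarrow> g (f s) = s"
    and f: "continuous_on S f" "(f has_real_derivative D) (at t)" "D \<noteq> 0"
  shows "(g has_real_derivative 1 / D) (at (f t))"
proof -
  have "(g has_derivative (\<lambda>x. x / D)) (at (f t))"
  proof (rule has_derivative_inverse_strong[OF S f(1) g])
    show "(f has_derivative (*) D) (at t)" using f(2) by (simp add: has_field_derivative_def)
    show "(*) D \<circ> (\<lambda>x. x / D) = id" using f(3) by auto
  qed
  moreover have "(\<lambda>x. x / D) = (*) (1 / D)" by auto
  ultimately show ?thesis by (simp add: has_field_derivative_def)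
qed

lemma inverse_second_DERIV:
  fixes f f1 H p p1 :: "real \<Rightarrow> real"
  assumes H: "(H has_real_derivative p1 t / f1 (H t)) (at t)"
    and p1: "(p1 has_real_derivative p2) (at t)"
    and f1: "(f1 has_real_derivative f2) (at (H t))" "f1 (H t) \<noteq> 0"
  shows "((\<lambda>t. p1 t / f1 (H t)) has_real_derivative
    (p2 - f2 * (p1 t / f1 (H t))\<^sup>2) / f1 (H t)) (at t)"
proof -
  have "((\<lambda>t. f1 (H t)) has_real_derivative f2 * (p1 t / f1 (H t))) (at t)"
    using DERIV_chain2[OF f1(1) H] .
  from DERIV_divide[OF p1 this f1(2)] show ?thesis
    using f1(2) by (simp add: power2_eq_square field_simps)
qed

locale steady_state =
  fixes \<phi> \<phi>t :: "real \<Rightarrow> real" and a b :: ereal and \<psi> :: "real \<times> real \<Rightarrow> real"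
  assumes ext: "monotone_analytic_extension \<phi> a b \<phi>t"
    and steady: "\<psi> \<in> steady_class \<phi>"
    and range: "\<psi> ` cstrip \<subseteq> \<phi>t ` einterval a b"
begin

abbreviation I where "I \<equiv> einterval a b"
abbreviation "\<phi>1 \<equiv> deriv \<phi>t"
abbreviation "\<phi>2 \<equiv> deriv \<phi>1"
abbreviation "\<omega> \<equiv> laplacian \<psi>"

definition level :: "real \<Rightarrow> real" where "level = inv_into I \<phi>t"
text \<open>For the shear flow itself \<open>height (x, y) = y\<close>, so that uniqueness becomes a statement about
\<open>height\<close>.\<close>

definition height :: "real \<times> real \<Rightarrow> real" where "height p = level (\<psi> p)"

lemma I_open: "open I" and I_sub: "{-1..1} \<subseteq> I"
  using ext by (auto simp: monotone_analytic_extension_def)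

lemma \<phi>_eq: "y \<in> {-1..1} \<Longrightarrow> \<phi> y = \<phi>t y"
  using ext by (auto simp: monotone_analytic_extension_def)

lemma \<phi>t_hol: "hol_ext_on \<phi>t I"
proof (rule real_analytic_imp_hol_ext_on)
  show "real_analytic_on1 \<phi>t I" using ext by (simp add: monotone_analytic_extension_def)
  show "t islimpt I" if "t \<in> I" for t
    using that I_open by (simp add: interior_limit_point interior_open)
qed

lemma \<phi>1_hol: "hol_ext_on \<phi>1 I" and \<phi>2_hol: "hol_ext_on \<phi>2 I"
  using \<phi>t_hol I_open by (simp_all add: hol_ext_on_deriv)

lemma \<phi>t_DERIV: "t \<in> I \<Longrightarrow> (\<phi>t has_real_derivative \<phi>1 t) (at t)"
  using \<phi>t_hol I_open by (rule hol_ext_on_open_DERIV)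

lemma \<phi>1_DERIV: "t \<in> I \<Longrightarrow> (\<phi>1 has_real_derivative \<phi>2 t) (at t)"
  using \<phi>1_hol I_open by (rule hol_ext_on_open_DERIV)

lemma \<phi>1_pos: "t \<in> I \<Longrightarrow> \<phi>1 t > 0"
  using ext by (auto simp: monotone_analytic_extension_def)

lemma \<phi>t_less: "s \<in> I \<Longrightarrow> t \<in> I \<Longrightarrow> s < t \<Longrightarrow> \<phi>t s < \<phi>t t"
proof -
  assume st: "s \<in> I" "t \<in> I" "s < t"
  have "u \<in> I" if "s \<le> u" "u \<le> t" for u
    using st that by (auto simp: einterval_def)
      (meson ereal_less_eq(3) order_less_le_trans order_le_less_trans)+
  then show ?thesis
    by (intro DERIV_pos_imp_increasing[OF st(3)] exI conjI) (auto intro: \<phi>t_DERIV \<phi>1_pos)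
qed

lemma \<phi>t_less_iff: "s \<in> I \<Longrightarrow> t \<in> I \<Longrightarrow> \<phi>t s < \<phi>t t \<longleftrightarrow> s < t"
  using \<phi>t_less[of s t] \<phi>t_less[of t s] by (cases s t rule: linorder_cases) auto

lemma level: "t \<in> I \<Longrightarrow> level (\<phi>t t) = t"
proof -
  assume "t \<in> I"
  moreover have "inj_on \<phi>t I"
    by (rule inj_onI) (metis \<phi>t_less linorder_neqE_linordered_idom order_less_irrefl)
  ultimately show ?thesis by (simp add: level_def)
qed

lemma level_DERIV: "t \<in> I \<Longrightarrow> (level has_real_derivative 1 / \<phi>1 t) (at (\<phi>t t))"
  by (rule inverse_DERIV[OF I_open _ level hol_ext_on_continuous[OF \<phi>t_hol] \<phi>t_DERIV])
    (use \<phi>1_pos in force)+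

lemma level_continuous: "continuous_on (\<phi>t ` I) level"
  unfolding continuous_on_eq_continuous_within
  using level_DERIV DERIV_isCont continuous_at_imp_continuous_at_within by blast

lemma level_hol: "hol_ext_on level (\<phi>t ` I)"
  by (rule hol_ext_on_inverse[OF \<phi>t_hol I_open _ level level_continuous]) (use \<phi>1_pos in force)

lemma height: "p \<in> cstrip \<Longrightarrow> height p \<in> I" "p \<in> cstrip \<Longrightarrow> \<phi>t (height p) = \<psi> p"
proof -
  assume "p \<in> cstrip"
  then obtain t where "t \<in> I" "\<psi> p = \<phi>t t" using range by blast
  then show "height p \<in> I" "\<phi>t (height p) = \<psi> p" by (simp_all add: height_def level)
qed

lemma \<psi>_analytic: "real_analytic_on2 \<psi> cstrip"
  and euler: "p \<in> strip \<Longrightarrow> perp_grad \<psi> p \<bullet> grad \<omega> p = 0"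
  and boundary: "\<psi> (x, 1) = \<phi> 1" "\<psi> (x, -1) = \<phi> (-1)"
  and limit: "((\<lambda>x. C2_norm (\<lambda>y. \<psi> (x, y) - \<phi> y)) \<longlongrightarrow> 0) at_infinity"
  using steady by (auto simp: steady_class_def)

lemma \<psi>_analytic_strip: "real_analytic_on2 \<psi> strip"
  by (rule real_analytic_on2_subset[OF \<psi>_analytic]) (auto simp: strip_def cstrip_def)

lemma \<psi>_continuous: "continuous_on cstrip \<psi>"
  by (rule real_analytic_on2_continuous[OF \<psi>_analytic cstrip_corner])

lemmas pdx_\<psi> = real_analytic_on2_pdx[OF \<psi>_analytic_strip open_strip]
lemmas pdy_\<psi> = real_analytic_on2_pdy[OF \<psi>_analytic_strip open_strip]
lemmas pdxx_\<psi> = real_analytic_on2_pdx[OF pdx_\<psi>(1) open_strip]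
lemmas pdyy_\<psi> = real_analytic_on2_pdy[OF pdy_\<psi>(1) open_strip]

lemma \<omega>_analytic: "real_analytic_on2 \<omega> strip"
  using real_analytic_on2_add[OF pdxx_\<psi>(1) pdyy_\<psi>(1)] by (simp add: laplacian_def[abs_def])

lemma row_hol:
  assumes "real_analytic_on2 f strip" "y \<in> {-1<..<1}"
  shows "hol_ext_on (\<lambda>x. f (x, y)) UNIV"
proof -
  have "{x. (x, y) \<in> strip} = UNIV" using assms(2) by (auto simp: mem_strip)
  with real_analytic_on2_row[OF assms(1), of y]
  have "real_analytic_on1 (\<lambda>x. f (x, y)) UNIV" by simp
  then show ?thesis by (rule real_analytic_imp_hol_ext_on) (simp add: islimpt_UNIV)
qed

text \<open>In the open strip the one-sided derivatives entering the norm are the partial derivatives of \<open>\<psi>\<close>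
and the derivatives of \<open>\<phi>t\<close>.\<close>

lemma C2_norm_bounds:
  fixes x :: real
  defines "d \<equiv> C2_norm (\<lambda>y. \<psi> (x, y) - \<phi> y)"
  shows "y \<in> {-1..1} \<Longrightarrow> \<bar>\<psi> (x, y) - \<phi>t y\<bar> \<le> d"
    and "y \<in> {-1<..<1} \<Longrightarrow> \<bar>pdy \<psi> (x, y) - \<phi>1 y\<bar> \<le> d"
    and "y \<in> {-1<..<1} \<Longrightarrow> \<bar>pdy (pdy \<psi>) (x, y) - \<phi>2 y\<bar> \<le> d"
proof -
  define u where "u y = \<psi> (x, y) - \<phi> y" for y
  have "{y. (x, y) \<in> cstrip} = {-1..1}" by (auto simp: mem_cstrip)
  with real_analytic_on2_column[OF \<psi>_analytic, of x]
  have "hol_ext_on (\<lambda>y. \<psi> (x, y)) {-1..1}"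
    by (intro real_analytic_imp_hol_ext_on islimpt_unit_interval) auto
  moreover have "hol_ext_on \<phi> {-1..1}"
    using \<phi>t_hol I_sub \<phi>_eq unfolding hol_ext_on_def by (metis subsetD)
  ultimately have u: "hol_ext_on u {-1..1}" unfolding u_def by (rule hol_ext_on_diff)
  have 1: "(u has_real_derivative pdy \<psi> (x, t) - \<phi>1 t) (at t)" if t: "t \<in> {-1<..<1}" for t
  proof -
    have "((\<lambda>y. \<psi> (x, y) - \<phi>t y) has_real_derivative pdy \<psi> (x, t) - \<phi>1 t) (at t)"
      using t I_sub by (intro DERIV_diff pdy_\<psi>(2) \<phi>t_DERIV) (auto simp: mem_strip)
    then show ?thesis
      by (rule has_field_derivative_transform_within_open[OF _ open_greaterThanLessThan t])
        (simp add: u_def \<phi>_eq)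
  qed
  have I1: "deriv_I u t = pdy \<psi> (x, t) - \<phi>1 t" if t: "t \<in> {-1<..<1}" for t
    using 1[OF t] t by (rule deriv_I_interior)
  have 2: "deriv_I (deriv_I u) t = pdy (pdy \<psi>) (x, t) - \<phi>2 t" if t: "t \<in> {-1<..<1}" for t
  proof (rule deriv_I_interior[OF _ t])
    have "((\<lambda>t. pdy \<psi> (x, t) - \<phi>1 t) has_real_derivative pdy (pdy \<psi>) (x, t) - \<phi>2 t) (at t)"
      using t I_sub by (intro DERIV_diff pdyy_\<psi>(2) \<phi>1_DERIV) (auto simp: mem_strip)
    then show "(deriv_I u has_real_derivative pdy (pdy \<psi>) (x, t) - \<phi>2 t) (at t)"
      by (rule has_field_derivative_transform_within_open[OF _ open_greaterThanLessThan t])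
        (simp add: I1)
  qed
  have d: "d = C2_norm u" by (simp add: d_def u_def[abs_def])
  show "\<bar>\<psi> (x, y) - \<phi>t y\<bar> \<le> d" if "y \<in> {-1..1}"
    using abs_le_C2_norm[OF u _ that, of 0] by (simp add: d u_def \<phi>_eq[OF that])
  show "\<bar>pdy \<psi> (x, y) - \<phi>1 y\<bar> \<le> d" if y: "y \<in> {-1<..<1}"
    using abs_le_C2_norm[OF u, of 1 y] y by (simp add: d I1)
  show "\<bar>pdy (pdy \<psi>) (x, y) - \<phi>2 y\<bar> \<le> d" if y: "y \<in> {-1<..<1}"
    using abs_le_C2_norm[OF u, of 2 y] y by (simp add: d 2 eval_nat_numeral)
qed

lemma C2_norm_small:
  assumes "e > 0"
  obtains R where "R > 0" "\<And>x. \<bar>x\<bar> \<ge> R \<Longrightarrow> C2_norm (\<lambda>y. \<psi> (x, y) - \<phi> y) < e"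
proof -
  have "\<forall>\<^sub>F x in at_infinity. dist (C2_norm (\<lambda>y. \<psi> (x, y) - \<phi> y)) 0 < e"
    using limit assms by (rule tendstoD)
  then obtain B where "\<And>x. norm x \<ge> B \<Longrightarrow> dist (C2_norm (\<lambda>y. \<psi> (x, y) - \<phi> y)) 0 < e"
    unfolding eventually_at_infinity by blast
  then show ?thesis by (intro that[of "max B 1"]) (auto simp: dist_real_def abs_less_iff)
qed

lemma \<phi>1_lower_bound:
  obtains m where "m > 0" "\<And>t. t \<in> {-1..1} \<Longrightarrow> m \<le> \<phi>1 t"
proof -
  have "continuous_on {-1..1} \<phi>1"
    by (rule continuous_on_subset[OF hol_ext_on_continuous[OF \<phi>1_hol] I_sub])
  then obtain s where "s \<in> {-1..1}" "\<And>t. t \<in> {-1..1} \<Longrightarrow> \<phi>1 s \<le> \<phi>1 t"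
    using continuous_attains_inf[of "{-1..1}" \<phi>1] by auto
  then show ?thesis using that[of "\<phi>1 s"] \<phi>1_pos I_sub by blast
qed

lemma pdy_pos_far:
  obtains R where "R > 0" "\<And>x y. \<bar>x\<bar> \<ge> R \<Longrightarrow> y \<in> {-1<..<1} \<Longrightarrow> pdy \<psi> (x, y) > 0"
proof -
  obtain m where m: "m > 0" "\<And>t. t \<in> {-1..1} \<Longrightarrow> m \<le> \<phi>1 t" by (rule \<phi>1_lower_bound, rule that)
  obtain R where R: "R > 0" "\<And>x. \<bar>x\<bar> \<ge> R \<Longrightarrow> C2_norm (\<lambda>y. \<psi> (x, y) - \<phi> y) < m"
    by (rule C2_norm_small[OF m(1)], rule that)
  have "pdy \<psi> (x, y) > 0" if "\<bar>x\<bar> \<ge> R" "y \<in> {-1<..<1}" for x y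
    using C2_norm_bounds(2)[OF that(2), of x] R(2)[OF that(1)] m(2)[of y] that(2) by auto
  then show ?thesis using that R(1) by blast
qed

lemma column_limits:
  shows "y \<in> {-1..1} \<Longrightarrow> ((\<lambda>x. \<psi> (x, y)) \<longlongrightarrow> \<phi>t y) at_top"
    and "y \<in> {-1<..<1} \<Longrightarrow> ((\<lambda>x. pdy (pdy \<psi>) (x, y)) \<longlongrightarrow> \<phi>2 y) at_top"
proof -
  have lim: "((\<lambda>x. C2_norm (\<lambda>y. \<psi> (x, y) - \<phi> y)) \<longlongrightarrow> 0) at_top"
    using limit at_top_le_at_infinity by (rule tendsto_mono[rotated])
  show "((\<lambda>x. \<psi> (x, y)) \<longlongrightarrow> \<phi>t y) at_top" if "y \<in> {-1..1}"
    by (rule Lim_transform[OF tendsto_const], rule Lim_null_comparison[OF _ lim])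
      (use C2_norm_bounds(1)[OF that] in \<open>simp add: abs_minus_commute\<close>)
  show "((\<lambda>x. pdy (pdy \<psi>) (x, y)) \<longlongrightarrow> \<phi>2 y) at_top" if "y \<in> {-1<..<1}"
    by (rule Lim_transform[OF tendsto_const], rule Lim_null_comparison[OF _ lim])
      (use C2_norm_bounds(3)[OF that] in \<open>simp add: abs_minus_commute\<close>)
qed

text \<open>Where \<open>\<psi>\<close> increases in \<open>y\<close>, its values lie strictly between the two boundary values, which
\<open>\<phi>t\<close> attains at \<open>-1\<close> and \<open>1\<close>.\<close>

lemma height_in_unit:
  assumes pos: "\<And>y. y \<in> {-1<..<1} \<Longrightarrow> pdy \<psi> (x, y) > 0" and y: "y \<in> {-1<..<1}"
  shows "height (x, y) \<in> {-1<..<1}"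
proof -
  have cont: "continuous_on {-1..1} (\<lambda>y. \<psi> (x, y))"
    by (rule continuous_on_compose2[OF \<psi>_continuous])
      (auto simp: mem_cstrip intro!: continuous_intros)
  have mono: "\<psi> (x, s) < \<psi> (x, t)" if "-1 \<le> s" "s < t" "t \<le> 1" for s t
  proof (rule DERIV_pos_imp_increasing_open[OF that(2)])
    fix r assume "s < r" "r < t"
    then have "r \<in> {-1<..<1}" using that by auto
    then show "\<exists>d. ((\<lambda>t. \<psi> (x, t)) has_real_derivative d) (at r) \<and> 0 < d"
      using pdy_\<psi>(2)[of x r] pos[of r] by (auto simp: mem_strip)
  qed (rule continuous_on_subset[OF cont], use that in auto)
  have c: "(x, y) \<in> cstrip" using y by (auto simp: mem_cstrip)
  have "\<phi>t (-1) < \<phi>t (height (x, y))" "\<phi>t (height (x, y)) < \<phi>t 1"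
    using mono[of "-1" y] mono[of y 1] y boundary[of x] by (auto simp: height(2)[OF c] \<phi>_eq)
  moreover have "-1 \<in> I" "1 \<in> I" using I_sub by auto
  ultimately show ?thesis using \<phi>t_less_iff height(1)[OF c] by auto
qed

text \<open>Far to the right the vorticity is a continuous function \<open>G\<close> of \<open>\<psi>\<close>. To identify \<open>G\<close>, let
\<open>x\<close> tend to infinity at fixed \<open>y\<close>: then \<open>\<psi>\<close> and \<open>pdy (pdy \<psi>)\<close> converge, hence so
does \<open>pdx (pdx \<psi>) = G (\<psi>) - pdy (pdy \<psi>)\<close>, and its limit must be \<open>0\<close> because \<open>\<psi>\<close>
converges.\<close>

lemma vorticity_far:
  obtains R where "\<And>x y. x > R \<Longrightarrow> y \<in> {-1<..<1} \<Longrightarrow> \<omega> (x, y) = \<phi>2 (height (x, y))"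
proof -
  obtain R where R: "R > 0" "\<And>x y. \<bar>x\<bar> \<ge> R \<Longrightarrow> y \<in> {-1<..<1} \<Longrightarrow> pdy \<psi> (x, y) > 0"
    by (rule pdy_pos_far, rule that)
  have pos: "pdy \<psi> (x, y) > 0" if "x > R" "y \<in> {-1<..<1}" for x y
    using R that by auto
  have eu: "pdx \<psi> (x, y) * pdy \<omega> (x, y) = pdy \<psi> (x, y) * pdx \<omega> (x, y)"
    if "x > R" "y \<in> {-1<..<1}" for x y
    using euler[of "(x, y)"] that by (simp add: mem_strip perp_grad_def grad_def)
  obtain G where G: "continuous_on {\<phi> (-1)<..<\<phi> 1} G" "\<And>x y. x > R \<Longrightarrow> y \<in> {-1<..<1} \<Longrightarrow>
        \<psi> (x, y) \<in> {\<phi> (-1)<..<\<phi> 1} \<and> \<omega> (x, y) = G (\<psi> (x, y))"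
    by (rule constant_along_level_curves[of \<psi> \<omega> R "\<phi> (-1)" "\<phi> 1",
          OF \<psi>_analytic_strip \<omega>_analytic \<psi>_continuous _ boundary(2,1)],
        rule eu, assumption, assumption, rule pos, assumption, assumption, rule that)
  have G\<phi>: "G (\<phi>t y) = \<phi>2 y" if y: "y \<in> {-1<..<1}" for y
  proof -
    have "\<phi>t y \<in> {\<phi> (-1)<..<\<phi> 1}"
      using y \<phi>t_less[of "-1" y] \<phi>t_less[of y 1] I_sub by (auto simp: \<phi>_eq subset_iff)
    then have "isCont G (\<phi>t y)"
      using G(1) continuous_on_eq_continuous_at[OF open_greaterThanLessThan] by blast
    then have "((\<lambda>x. G (\<psi> (x, y))) \<longlongrightarrow> G (\<phi>t y)) at_top"
      by (rule isCont_tendsto_compose[OF _ column_limits(1)]) (use y in simp)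
    from tendsto_diff[OF this column_limits(2)[OF y]]
    have "((\<lambda>x. G (\<psi> (x, y)) - pdy (pdy \<psi>) (x, y)) \<longlongrightarrow> G (\<phi>t y) - \<phi>2 y) at_top" .
    moreover have "\<forall>\<^sub>F x in at_top. G (\<psi> (x, y)) - pdy (pdy \<psi>) (x, y) = pdx (pdx \<psi>) (x, y)"
      using eventually_gt_at_top[of R] by eventually_elim (use G(2)[OF _ y] in \<open>fastforce simp: laplacian_def\<close>)
    ultimately have lim: "((\<lambda>x. pdx (pdx \<psi>) (x, y)) \<longlongrightarrow> G (\<phi>t y) - \<phi>2 y) at_top"
      by (rule Lim_transform_eventually)
    have "G (\<phi>t y) - \<phi>2 y = 0"
    proof (rule limit_second_derivative_zero[OF column_limits(1) _ _ lim])
      show "((\<lambda>x. \<psi> (x, y)) has_real_derivative pdx \<psi> (x, y)) (at x)"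
        "((\<lambda>x. pdx \<psi> (x, y)) has_real_derivative pdx (pdx \<psi>) (x, y)) (at x)" for x
        using pdx_\<psi>(2)[of x y] pdxx_\<psi>(2)[of x y] y by (auto simp: mem_strip)
    qed (use y in auto)
    then show ?thesis by simp
  qed
  have "\<omega> (x, y) = \<phi>2 (height (x, y))" if xy: "x > R" "y \<in> {-1<..<1}" for x y
  proof -
    have "height (x, y) \<in> {-1<..<1}"
      by (rule height_in_unit) (use pos xy in auto)
    moreover have "\<phi>t (height (x, y)) = \<psi> (x, y)"
      using xy by (intro height) (auto simp: mem_cstrip)
    ultimately show ?thesis using G(2)[OF xy] G\<phi> by metis
  qed
  then show ?thesis by (rule that)
qed

text \<open>Along each horizontal line both sides are real-analytic and agree far to the right. The range
hypothesis enters here: the right-hand side makes sense on the whole line only because every value of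
\<open>\<psi>\<close> is attained by \<open>\<phi>t\<close>.\<close>

lemma vorticity: 
  assumes y: "y \<in> {-1<..<1}"
  shows "\<omega> (x, y) = \<phi>2 (height (x, y))"
proof -
  obtain R where R: "\<And>x. x > R \<Longrightarrow> \<omega> (x, y) = \<phi>2 (height (x, y))"
    using vorticity_far y by metis
  have c: "(x, y) \<in> cstrip" for x using y by (auto simp: mem_cstrip)
  have "hol_ext_on (\<lambda>x. level (\<psi> (x, y))) UNIV"
    by (rule hol_ext_on_compose[OF level_hol row_hol[OF \<psi>_analytic_strip y]]) (use range c in auto)
  then have h: "hol_ext_on (\<lambda>x. height (x, y)) UNIV" by (simp add: height_def)
  have "hol_ext_on (\<lambda>x. \<omega> (x, y) - \<phi>2 (height (x, y))) UNIV"
    by (intro hol_ext_on_diff row_hol[OF \<omega>_analytic y] hol_ext_on_compose[OF \<phi>2_hol h])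
      (use height(1) c in auto)
  then have "\<omega> (x, y) - \<phi>2 (height (x, y)) = 0"
    by (rule hol_ext_on_zero_propagates[where R = R]) (use R in simp)
  then show ?thesis by simp
qed

end

section \<open>Uniqueness\<close>

context steady_state
begin

lemma height_boundary: "height (x, -1) = -1" "height (x, 1) = 1"
  using boundary[of x] I_sub by (simp_all add: height_def \<phi>_eq level subset_iff)

lemma height_continuous: "continuous_on cstrip height"
  unfolding height_def
  by (rule continuous_on_compose2[OF level_continuous \<psi>_continuous range])

lemma height_far_in_unit:
  obtains R where "\<And>x y. \<bar>x\<bar> \<ge> R \<Longrightarrow> y \<in> {-1..1} \<Longrightarrow> height (x, y) \<in> {-1..1}"
proof -
  obtain R where R: "R > 0" "\<And>x y. \<bar>x\<bar> \<ge> R \<Longrightarrow> y \<in> {-1<..<1} \<Longrightarrow> pdy \<psi> (x, y) > 0"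
    by (rule pdy_pos_far, rule that)
  have "height (x, y) \<in> {-1..1}" if x: "\<bar>x\<bar> \<ge> R" and y: "y \<in> {-1..1}" for x y
  proof (cases "y \<in> {-1<..<1}")
    case True
    have "height (x, y) \<in> {-1<..<1}"
      by (rule height_in_unit[OF _ True]) (use R(2) x in auto)
    then show ?thesis by simp
  next
    case False
    then have "y = -1 \<or> y = 1" using y by auto
    then show ?thesis using height_boundary by auto
  qed
  then show ?thesis by (rule that)
qed

text \<open>Far out, both \<open>height (x, y)\<close> and \<open>y\<close> lie in \<open>[-1,1]\<close>, where \<open>\<phi>t\<close> expands distances by at
least the factor \<open>m > 0\<close>; their images \<open>\<psi> (x, y)\<close> and \<open>\<phi>t y\<close> are close.\<close>

lemma height_limit:
  assumes "\<delta> > 0"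
  shows "\<exists>R. \<forall>x y. \<bar>x\<bar> \<ge> R \<longrightarrow> y \<in> {-1..1} \<longrightarrow> \<bar>height (x, y) - y\<bar> \<le> \<delta>"
proof -
  obtain m where m: "m > 0" "\<And>t. t \<in> {-1..1} \<Longrightarrow> m \<le> \<phi>1 t" by (rule \<phi>1_lower_bound, rule that)
  have less: "m * (t - s) \<le> \<phi>t t - \<phi>t s" if st: "s \<in> {-1..1}" "t \<in> {-1..1}" "s < t" for s t
  proof -
    obtain z where z: "s < z" "z < t" "\<phi>t t - \<phi>t s = (t - s) * \<phi>1 z"
      using MVT2[OF st(3), of \<phi>t \<phi>1] \<phi>t_DERIV I_sub st by (auto simp: subset_iff)
    then have "(t - s) * m \<le> (t - s) * \<phi>1 z" using m(2)[of z] st by (intro mult_left_mono) auto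
    then show ?thesis by (simp add: z(3) mult.commute)
  qed
  have expand: "m * \<bar>t - s\<bar> \<le> \<bar>\<phi>t t - \<phi>t s\<bar>" if "s \<in> {-1..1}" "t \<in> {-1..1}" for s t
    using less[OF that] less[OF that(2,1)]
    by (cases s t rule: linorder_cases) (auto simp: abs_if split: if_splits)
  obtain R1 where R1: "\<And>x y. \<bar>x\<bar> \<ge> R1 \<Longrightarrow> y \<in> {-1..1} \<Longrightarrow> height (x, y) \<in> {-1..1}"
    by (rule height_far_in_unit, rule that)
  have m\<delta>: "m * \<delta> > 0" using m(1) assms by simp
  obtain R2 where R2: "R2 > 0" "\<And>x. \<bar>x\<bar> \<ge> R2 \<Longrightarrow> C2_norm (\<lambda>y. \<psi> (x, y) - \<phi> y) < m * \<delta>"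
    by (rule C2_norm_small[OF m\<delta>], rule that)
  have "\<bar>height (x, y) - y\<bar> \<le> \<delta>" if x: "\<bar>x\<bar> \<ge> max R1 R2" and y: "y \<in> {-1..1}" for x y
  proof -
    have "m * \<bar>height (x, y) - y\<bar> \<le> \<bar>\<psi> (x, y) - \<phi>t y\<bar>"
      using expand[OF y R1[of x y]] x y height(2)[of "(x, y)"] by (simp add: mem_cstrip)
    also have "\<dots> < m * \<delta>" using C2_norm_bounds(1)[OF y, of x] R2(2)[of x] x by simp
    finally show ?thesis using m(1) by simp
  qed
  then show ?thesis by blast
qed

text \<open>The ratio may blow up at the ends of the interval \<open>I\<close>, but the heights stay in a compact part of
it: they lie in \<open>[-1,1]\<close> far out, and the rest of the strip is compact.\<close>

lemma curvature_ratio_bounded: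
  obtains K where "\<And>p. p \<in> cstrip \<Longrightarrow> \<bar>\<phi>2 (height p) / \<phi>1 (height p)\<bar> \<le> K"
proof -
  obtain R where R: "\<And>x y. \<bar>x\<bar> \<ge> R \<Longrightarrow> y \<in> {-1..1} \<Longrightarrow> height (x, y) \<in> {-1..1}"
    by (rule height_far_in_unit, rule that)
  define Q where "Q = {-R..R} \<times> {-1..1::real}"
  define C where "C = height ` Q \<union> {-1..1}"
  have Q: "Q \<subseteq> cstrip" by (auto simp: Q_def mem_cstrip)
  have "compact Q" unfolding Q_def by (intro compact_Times) auto
  then have "compact C" unfolding C_def
    by (intro compact_Un compact_continuous_image continuous_on_subset[OF height_continuous Q]) auto
  moreover have CI: "C \<subseteq> I" using height(1) Q I_sub by (auto simp: C_def)
  have "continuous_on C (\<lambda>t. \<phi>2 t / \<phi>1 t)"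
    using \<phi>1_pos CI
    by (intro continuous_on_divide continuous_on_subset[OF hol_ext_on_continuous[OF \<phi>1_hol]]
        continuous_on_subset[OF hol_ext_on_continuous[OF \<phi>2_hol]]) fastforce+
  ultimately have "bounded ((\<lambda>t. \<phi>2 t / \<phi>1 t) ` C)"
    by (intro compact_imp_bounded compact_continuous_image)
  then obtain K where K: "\<And>t. t \<in> C \<Longrightarrow> \<bar>\<phi>2 t / \<phi>1 t\<bar> \<le> K"
    unfolding bounded_iff by auto
  have "height p \<in> C" if p: "p \<in> cstrip" for p
  proof -
    obtain x y where xy: "p = (x, y)" "y \<in> {-1..1}" using p by (cases p) (auto simp: mem_cstrip)
    show ?thesis
    proof (cases "\<bar>x\<bar> \<ge> R")
      case True
      then show ?thesis using R xy by (auto simp: C_def)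
    next
      case False
      then have "p \<in> Q" using xy by (auto simp: Q_def)
      then show ?thesis by (auto simp: C_def)
    qed
  qed
  then show ?thesis using K that by blast
qed

text \<open>The partial derivatives of \<open>height\<close>, obtained by differentiating \<open>\<phi>t (height p) = \<psi> p\<close> once
and twice.\<close>

definition height_x where "height_x p = pdx \<psi> p / \<phi>1 (height p)"
definition height_y where "height_y p = pdy \<psi> p / \<phi>1 (height p)"
definition height_xx where
  "height_xx p = (pdx (pdx \<psi>) p - \<phi>2 (height p) * (height_x p)\<^sup>2) / \<phi>1 (height p)"
definition height_yy where
  "height_yy p = (pdy (pdy \<psi>) p - \<phi>2 (height p) * (height_y p)\<^sup>2) / \<phi>1 (height p)"

lemma height_derivs:
  assumes y: "y \<in> {-1<..<1}"
  shows "((\<lambda>t. height (t, y)) has_real_derivative height_x (x, y)) (at x)"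
    and "((\<lambda>t. height (x, t)) has_real_derivative height_y (x, y)) (at y)"
    and "((\<lambda>t. height_x (t, y)) has_real_derivative height_xx (x, y)) (at x)"
    and "((\<lambda>t. height_y (x, t)) has_real_derivative height_yy (x, y)) (at y)"
proof -
  have s: "(x, y) \<in> strip" and c: "(x, y) \<in> cstrip"
    using y by (auto simp: mem_strip mem_cstrip)
  note h = height[OF c]
  have lev: "(level has_real_derivative 1 / \<phi>1 (height (x, y))) (at (\<psi> (x, y)))"
    using level_DERIV[OF h(1)] by (simp add: h(2))
  show 1: "((\<lambda>t. height (t, y)) has_real_derivative height_x (x, y)) (at x)"
    using DERIV_chain2[OF lev pdx_\<psi>(2)[OF s]] by (simp add: height_def height_x_def)
  show 2: "((\<lambda>t. height (x, t)) has_real_derivative height_y (x, y)) (at y)"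
    using DERIV_chain2[OF lev pdy_\<psi>(2)[OF s]] by (simp add: height_def height_y_def)
  have nz: "\<phi>1 (height (x, y)) \<noteq> 0" using \<phi>1_pos[OF h(1)] by simp
  show "((\<lambda>t. height_x (t, y)) has_real_derivative height_xx (x, y)) (at x)"
    using inverse_second_DERIV[OF 1[unfolded height_x_def] pdxx_\<psi>(2)[OF s] \<phi>1_DERIV[OF h(1)] nz]
    by (simp add: height_x_def height_xx_def)
  show "((\<lambda>t. height_y (x, t)) has_real_derivative height_yy (x, y)) (at y)"
    using inverse_second_DERIV[OF 2[unfolded height_y_def] pdyy_\<psi>(2)[OF s] \<phi>1_DERIV[OF h(1)] nz]
    by (simp add: height_y_def height_yy_def)
qed

text \<open>In terms of the height, the semilinear equation for \<open>\<psi>\<close> loses its zeroth order source: the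
right-hand side vanishes whenever the gradient has length one, as it does for every translate
\<open>y + c\<close>. This is what makes a maximum principle applicable whatever the sign of \<open>\<phi>2\<close>.\<close>

lemma height_equation:
  fixes x :: real
  assumes y: "y \<in> {-1<..<1}"
  defines "p \<equiv> (x, y)"
  shows "height_xx p + height_yy p =
    \<phi>2 (height p) / \<phi>1 (height p) * (1 - (height_x p)\<^sup>2 - (height_y p)\<^sup>2)"
proof -
  have "pdx (pdx \<psi>) p + pdy (pdy \<psi>) p = \<phi>2 (height p)"
    using vorticity[OF y, of x] by (simp add: p_def laplacian_def)
  then have "height_xx p + height_yy p =
      (\<phi>2 (height p) - \<phi>2 (height p) * (height_x p)\<^sup>2 - \<phi>2 (height p) * (height_y p)\<^sup>2)
        / \<phi>1 (height p)"
    by (simp add: height_xx_def height_yy_def flip: add_divide_distrib)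
  then show ?thesis by (simp add: diff_divide_distrib right_diff_distrib)
qed

text \<open>The difference \<open>g = height - y\<close> vanishes on the boundary and at infinity, and its Laplacian is
\<open>- (\<phi>2 / \<phi>1) * (gx\<^sup>2 + gy\<^sup>2 + 2 * gy)\<close>, which contains no term in \<open>g\<close> alone. The maximum
principle applies to \<open>g\<close> and to \<open>- g\<close>.\<close>

lemma height_eq:
  assumes "y \<in> {-1..1}"
  shows "height (x, y) = y"
proof -
  obtain K where K: "\<And>p. p \<in> cstrip \<Longrightarrow> \<bar>\<phi>2 (height p) / \<phi>1 (height p)\<bar> \<le> K"
    by (rule curvature_ratio_bounded, rule that)
  define q where "q p = (height_x p)\<^sup>2 + (height_y p - 1)\<^sup>2 + 2 * \<bar>height_y p - 1\<bar>" for p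
  have ineq: "\<bar>height_xx (x, y) + height_yy (x, y)\<bar> \<le> K * q (x, y)" if y: "y \<in> {-1<..<1}" for x y
  proof -
    let ?p = "(x, y)"
    have "1 - (height_x ?p)\<^sup>2 - (height_y ?p)\<^sup>2
        = - ((height_x ?p)\<^sup>2 + (height_y ?p - 1)\<^sup>2 + 2 * (height_y ?p - 1))"
      by (simp add: power2_eq_square algebra_simps)
    also have "\<bar>\<dots>\<bar> \<le> q ?p"
      unfolding q_def abs_minus_cancel by (rule order_trans[OF abs_triangle_ineq])
        (simp add: abs_mult del: right_diff_distrib_numeral)
    finally have 1: "\<bar>1 - (height_x ?p)\<^sup>2 - (height_y ?p)\<^sup>2\<bar> \<le> q ?p" .
    have 2: "\<bar>\<phi>2 (height ?p) / \<phi>1 (height ?p)\<bar> \<le> K" using y by (intro K) (auto simp: mem_cstrip)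
    have "K \<ge> 0" using 2 by linarith
    then show ?thesis
      unfolding height_equation[OF y] abs_mult by (intro mult_mono 1 2) auto
  qed
  have cont: "continuous_on cstrip (\<lambda>p. height p - snd p)"
    by (intro continuous_intros height_continuous)
  have lim: "\<exists>R. \<forall>x y. \<bar>x\<bar> \<ge> R \<longrightarrow> y \<in> {-1..1} \<longrightarrow> \<bar>height (x, y) - y\<bar> \<le> \<delta>" if "\<delta> > 0" for \<delta>
    using that by (rule height_limit)
  have "height (x, y) - snd (x, y) \<le> 0"
  proof (rule strip_max_principle[where gx = height_x and gy = "\<lambda>p. height_y p - 1"
        and gxx = height_xx and gyy = height_yy and K = K])
    show "\<exists>R. \<forall>x y. \<bar>x\<bar> \<ge> R \<longrightarrow> y \<in> {-1..1} \<longrightarrow> height (x, y) - snd (x, y) \<le> \<delta>"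
      if "\<delta> > 0" for \<delta> using lim[OF that] by (force simp: abs_le_iff)
  qed (use ineq assms in \<open>auto simp: height_boundary q_def cont
        intro!: derivative_eq_intros height_derivs\<close>)
  moreover have "- (height (x, y) - snd (x, y)) \<le> 0"
  proof (rule strip_max_principle[where gx = "\<lambda>p. - height_x p" and gy = "\<lambda>p. - (height_y p - 1)"
        and gxx = "\<lambda>p. - height_xx p" and gyy = "\<lambda>p. - height_yy p" and K = K])
    show "\<exists>R. \<forall>x y. \<bar>x\<bar> \<ge> R \<longrightarrow> y \<in> {-1..1} \<longrightarrow> - (height (x, y) - snd (x, y)) \<le> \<delta>"
      if "\<delta> > 0" for \<delta> using lim[OF that] by (force simp: abs_le_iff)
    show "\<bar>- height_xx (x, y) + - height_yy (x, y)\<bar> \<le> K * ((- height_x (x, y))\<^sup>2 +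
        (- (height_y (x, y) - 1))\<^sup>2 + 2 * \<bar>- (height_y (x, y) - 1)\<bar>)"
      if "y \<in> {-1<..<1}" for x y
    proof -
      have "\<bar>- height_xx (x, y) + - height_yy (x, y)\<bar> = \<bar>height_xx (x, y) + height_yy (x, y)\<bar>"
        by (simp add: abs_if)
      then show ?thesis using ineq[OF that, of x] by (simp only: q_def power2_minus abs_minus_cancel)
    qed
    show "continuous_on cstrip (\<lambda>p. - (height p - snd p))" by (intro continuous_on_minus cont)
    fix x y :: real assume y: "y \<in> {-1<..<1}"
    have "((\<lambda>t. height (t, y) - y) has_real_derivative height_x (x, y)) (at x)"
      "((\<lambda>t. height (x, t) - t) has_real_derivative height_y (x, y) - 1) (at y)"
      "((\<lambda>t. height_y (x, t) - 1) has_real_derivative height_yy (x, y)) (at y)"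
      by (auto intro!: derivative_eq_intros height_derivs y)
    from this[THEN DERIV_minus] height_derivs(3)[OF y, THEN DERIV_minus]
    show "((\<lambda>t. - (height (t, y) - snd (t, y))) has_real_derivative - height_x (x, y)) (at x)"
      "((\<lambda>t. - (height (x, t) - snd (x, t))) has_real_derivative - (height_y (x, y) - 1)) (at y)"
      "((\<lambda>t. - height_x (t, y)) has_real_derivative - height_xx (x, y)) (at x)"
      "((\<lambda>t. - (height_y (x, t) - 1)) has_real_derivative - height_yy (x, y)) (at y)"
      by (simp_all only: snd_conv)
  qed (use assms in \<open>auto simp: height_boundary\<close>)
  ultimately show ?thesis by simp
qed

lemma \<psi>_eq_shear_flow: "\<psi> = shear_flow \<phi>"
proof (rule extensionalityI[of _ cstrip])
  show "\<psi> \<in> extensional cstrip" using steady by (simp add: steady_class_def)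
  show "shear_flow \<phi> \<in> extensional cstrip" by (simp add: shear_flow_def)
  fix p assume p: "p \<in> cstrip"
  then obtain x y where xy: "p = (x, y)" "y \<in> {-1..1}" by (cases p) (auto simp: mem_cstrip)
  have "\<psi> p = \<phi>t (height p)" using height(2)[OF p] by simp
  also have "\<dots> = \<phi> y" using height_eq[OF xy(2)] \<phi>_eq[OF xy(2)] by (simp add: xy(1))
  finally show "\<psi> p = shear_flow \<phi> p" using p by (simp add: shear_flow_def xy(1))
qed

end

theorem proposition4p3:
  fixes \<phi> \<phi>t :: "real \<Rightarrow> real" and a b :: ereal
  assumes "real_analytic_on1 \<phi> {-1..1}"
    and "\<forall>y\<in>{-1..1}. deriv_I \<phi> y > 0"
    and "maximal_monotone_analytic_extension \<phi> a b \<phi>t"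
    and "\<forall>\<psi>\<in>steady_class \<phi>. \<psi> ` cstrip \<subseteq> \<phi>t ` einterval a b"
  shows "steady_class \<phi> = {shear_flow \<phi>}"
proof -
  have "\<psi> = shear_flow \<phi>" if "\<psi> \<in> steady_class \<phi>" for \<psi>
  proof -
    interpret steady_state \<phi> \<phi>t a b \<psi>
      using assms(3,4) that by unfold_locales (auto simp: maximal_monotone_analytic_extension_def)
    show ?thesis by (rule \<psi>_eq_shear_flow)
  qed
  with shear_flow_in_steady_class[OF assms(1)] show ?thesis by blast
qed

end
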